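(* Let $0<\beta<2$ and $\beta\neq 1$. Then the operator $A$ (the Friedrichs extension in $L^2(0,1)$ of the operator $v\mapsto -(x^{\beta}v')'$ with the domain $D(A)$ described in the context) has a discrete spectrum.
   Context: All functions are real-valued. For $\beta\in(0,2)$, $\beta\neq1$, consider the operator $Av=-(x^{\beta}v')'$ whose domain $D(A)\subset L^2(0,1)$ consists of the functions $v$ such that: 1) $v\in C[0,1]$; 2) $x^{\beta}v'(x)\in C[0,1]$, $(x^{\beta}v'(x))'\in AC[0,1]$ (absolutely continuous functions), and $Av\in L^2(0,1)$; 3) $v^{(\mu)}(0)=0$ for the integers $\mu$ with $0\le \mu\le -[\beta]$ ($[\beta]$ is the integer part), and $v(1)=0$. That is: if $0<\beta<1$ then $v(0)=0$ and $v(1)=0$; if $1<\beta<2$ then only $v(1)=0$ is required. This operator is symmetric and positive definite in $L^2(0,1)$; its Friedrichs extension is again denoted by $A$. "Discrete spectrum" is meant in the usual sense: the spectrum consists of eigenvalues of finite multiplicity with no finite accumulation point; for this operator this amounts to the existence of a complete orthonormal system of eigenfunctions in $L^2(0,1)$ with eigenvalues tending to $+\infty$. *)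

theory Defs
  imports "HOL-Analysis.Analysis"
begin

section \<open>The real Hilbert space $L^2(0,1)$\<close>

abbreviation unit_ivl_measure :: "real measure" where
  "unit_ivl_measure \<equiv> lebesgue_on {0<..<1}"

definition square_integrable :: "(real \<Rightarrow> real) \<Rightarrow> bool" where
  "square_integrable f \<longleftrightarrow>
     f \<in> borel_measurable unit_ivl_measure \<and> integrable unit_ivl_measure (\<lambda>x. (f x)\<^sup>2)"

lemma square_integrable_mult:
  assumes "square_integrable f" "square_integrable g"
  shows "integrable unit_ivl_measure (\<lambda>x. f x * g x)"
proof (rule Bochner_Integration.integrable_bound)
  show "integrable unit_ivl_measure (\<lambda>x. (f x)\<^sup>2 + (g x)\<^sup>2)"
    using assms by (simp add: square_integrable_def)
  show "(\<lambda>x. f x * g x) \<in> borel_measurable unit_ivl_measure"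
    using assms by (auto simp: square_integrable_def)
  have "\<bar>a * b\<bar> \<le> a\<^sup>2 + b\<^sup>2" for a b :: real
  proof -
    have "2 * (\<bar>a\<bar> * \<bar>b\<bar>) \<le> a\<^sup>2 + b\<^sup>2"
      using sum_squares_bound[of "\<bar>a\<bar>" "\<bar>b\<bar>"] by simp
    moreover have "0 \<le> \<bar>a\<bar> * \<bar>b\<bar>"
      by simp
    ultimately show ?thesis
      unfolding abs_mult by linarith
  qed
  then show "AE x in unit_ivl_measure. norm (f x * g x) \<le> norm ((f x)\<^sup>2 + (g x)\<^sup>2)"
    by (auto simp: abs_mult)
qed

lemma square_integrable_zero: "square_integrable (\<lambda>x. 0)"
  by (simp add: square_integrable_def)

lemma square_integrable_add:
  assumes "square_integrable f" "square_integrable g"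
  shows "square_integrable (\<lambda>x. f x + g x)"
  using assms square_integrable_mult[OF assms]
  by (auto simp: square_integrable_def power2_sum mult.assoc)

lemma square_integrable_scale:
  assumes "square_integrable f"
  shows "square_integrable (\<lambda>x. c * f x)"
  using assms by (auto simp: square_integrable_def power_mult_distrib)

lemma square_integrable_uminus:
  assumes "square_integrable f"
  shows "square_integrable (\<lambda>x. - f x)"
  using square_integrable_scale[OF assms, of "-1"] by simp

lemma square_integrable_diff:
  assumes "square_integrable f" "square_integrable g"
  shows "square_integrable (\<lambda>x. f x - g x)"
  using square_integrable_add[OF assms(1) square_integrable_uminus[OF assms(2)]] by simp

definition L2_eq :: "(real \<Rightarrow> real) \<Rightarrow> (real \<Rightarrow> real) \<Rightarrow> bool" where
  "L2_eq f g \<longleftrightarrow> square_integrable f \<and> square_integrable g \<and>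
     (AE x in unit_ivl_measure. f x = g x)"

text \<open>For a function that is not square integrable, \<open>abs_L2\<close> returns an arbitrary
  value.\<close>

quotient_type L2 = "real \<Rightarrow> real" / partial: L2_eq
proof (rule part_equivpI)
  show "\<exists>f. L2_eq f f"
    by (auto simp: L2_eq_def intro!: exI[of _ "\<lambda>x. 0"] square_integrable_zero)
  show "symp L2_eq"
    by (auto simp: symp_def L2_eq_def)
  show "transp L2_eq"
    unfolding transp_def L2_eq_def by (auto elim: AE_mp)
qed

instantiation L2 :: real_inner
begin

lift_definition zero_L2 :: L2 is "\<lambda>x. 0"
  by (simp add: L2_eq_def square_integrable_zero)

lift_definition plus_L2 :: "L2 \<Rightarrow> L2 \<Rightarrow> L2" is "\<lambda>f g x. f x + g x"
  by (auto simp: L2_eq_def intro: square_integrable_add elim!: AE_mp)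

lift_definition minus_L2 :: "L2 \<Rightarrow> L2 \<Rightarrow> L2" is "\<lambda>f g x. f x - g x"
  by (auto simp: L2_eq_def intro: square_integrable_diff elim!: AE_mp)

lift_definition uminus_L2 :: "L2 \<Rightarrow> L2" is "\<lambda>f x. - f x"
  by (auto simp: L2_eq_def intro: square_integrable_uminus)

lift_definition scaleR_L2 :: "real \<Rightarrow> L2 \<Rightarrow> L2" is "\<lambda>c f x. c * f x"
  by (auto simp: L2_eq_def intro: square_integrable_scale)

lift_definition inner_L2 :: "L2 \<Rightarrow> L2 \<Rightarrow> real"
  is "\<lambda>f g. LINT x|unit_ivl_measure. f x * g x"
proof -
  fix f f' g g' :: "real \<Rightarrow> real"
  assume "L2_eq f f'" "L2_eq g g'"
  then show "(LINT x|unit_ivl_measure. f x * g x) = (LINT x|unit_ivl_measure. f' x * g' x)"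
    by (intro integral_cong_AE) (auto simp: L2_eq_def square_integrable_def elim!: AE_mp)
qed

definition norm_L2 :: "L2 \<Rightarrow> real" where "norm_L2 u = sqrt (inner u u)"
definition dist_L2 :: "L2 \<Rightarrow> L2 \<Rightarrow> real" where "dist_L2 u v = norm (u - v)"
definition sgn_L2 :: "L2 \<Rightarrow> L2" where "sgn_L2 u = inverse (norm u) *\<^sub>R u"
definition uniformity_L2 :: "(L2 \<times> L2) filter" where
  "uniformity_L2 = (INF e\<in>{0<..}. principal {(u, v). dist u v < e})"
definition open_L2 :: "L2 set \<Rightarrow> bool" where
  "open_L2 U = (\<forall>u\<in>U. eventually (\<lambda>(u', v). u' = u \<longrightarrow> v \<in> U) uniformity)"

instance
proof
  fix u v w :: L2 and a b :: real
  show "u + v + w = u + (v + w)"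
    by transfer (auto simp: L2_eq_def add.assoc intro!: square_integrable_add)
  show "u + v = v + u"
    by transfer (auto simp: L2_eq_def add.commute intro!: square_integrable_add)
  show "0 + u = u"
    by transfer (auto simp: L2_eq_def)
  show "- u + u = 0"
    by transfer (auto simp: L2_eq_def square_integrable_zero)
  show "u - v = u + - v"
    by transfer (auto simp: L2_eq_def intro!: square_integrable_diff)
  show "a *\<^sub>R (u + v) = a *\<^sub>R u + a *\<^sub>R v"
    by transfer (auto simp: L2_eq_def distrib_left
        intro!: square_integrable_add square_integrable_scale)
  show "(a + b) *\<^sub>R u = a *\<^sub>R u + b *\<^sub>R u"
    by transfer (auto simp: L2_eq_def distrib_right
        intro!: square_integrable_add square_integrable_scale)
  show "a *\<^sub>R b *\<^sub>R u = (a * b) *\<^sub>R u"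
    by transfer (auto simp: L2_eq_def mult.assoc intro!: square_integrable_scale)
  show "1 *\<^sub>R u = u"
    by transfer (auto simp: L2_eq_def)
  show "sgn u = inverse (norm u) *\<^sub>R u"
    by (rule sgn_L2_def)
  show "dist u v = norm (u - v)"
    by (rule dist_L2_def)
  show "(uniformity :: (L2 \<times> L2) filter) = (INF e\<in>{0<..}. principal {(u, v). dist u v < e})"
    by (rule uniformity_L2_def)
  show "open U = (\<forall>u\<in>U. \<forall>\<^sub>F (u', v) in uniformity. u' = u \<longrightarrow> v \<in> U)" for U :: "L2 set"
    by (rule open_L2_def)
  show "inner u v = inner v u"
    by transfer (simp add: mult.commute)
  show "inner (u + v) w = inner u w + inner v w"
    by transfer (simp add: L2_eq_def distrib_right square_integrable_mult)
  show "inner (a *\<^sub>R u) v = a * inner u v"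
    by transfer (simp add: mult.assoc)
  show "0 \<le> inner u u"
    by transfer simp
  show "inner u u = 0 \<longleftrightarrow> u = 0"
  proof transfer
    fix f :: "real \<Rightarrow> real"
    assume f: "L2_eq f f"
    then have "integrable unit_ivl_measure (\<lambda>x. f x * f x)"
      by (simp add: L2_eq_def square_integrable_mult)
    then have "(LINT x|unit_ivl_measure. f x * f x) = 0 \<longleftrightarrow>
        (AE x in unit_ivl_measure. f x * f x = 0)"
      by (intro integral_nonneg_eq_0_iff_AE) auto
    with f show "((LINT x|unit_ivl_measure. f x * f x) = 0) = L2_eq f (\<lambda>x. 0)"
      by (simp add: L2_eq_def square_integrable_zero)
  qed
  show "norm u = sqrt (inner u u)"
    by (rule norm_L2_def)
qed

end


section \<open>Unbounded operators, represented by their graphs\<close>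

definition adjoint_op :: "('a \<times> 'a) set \<Rightarrow> ('a::real_inner \<times> 'a) set" where
  "adjoint_op S = {(u, f). \<forall>(v, g)\<in>S. inner u g = inner f v}"

text \<open>The form domain (energy space) of a symmetric positive definite operator \<open>S\<close>: the
  completion of its domain in the norm $\langle Sv, v\rangle^{1/2}$, realised inside the
  ambient space as the set of limits of those sequences in the domain that are Cauchy in
  this norm.\<close>

definition form_domain :: "('a::real_inner \<times> 'a) set \<Rightarrow> 'a set" where
  "form_domain S = {u. \<exists>v g. (\<forall>n::nat. (v n, g n) \<in> S) \<and> v \<longlonglongrightarrow> u \<and>
     (\<forall>e>0. \<exists>N. \<forall>m\<ge>N. \<forall>n\<ge>N. inner (g m - g n) (v m - v n) < e)}"

text \<open>The Friedrichs extension is the restriction of the adjoint to the form domain.\<close>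

definition friedrichs_extension :: "('a::real_inner \<times> 'a) set \<Rightarrow> ('a \<times> 'a) set" where
  "friedrichs_extension S = {(u, f). (u, f) \<in> adjoint_op S \<and> u \<in> form_domain S}"

text \<open>The resolvent \<open>R\<close> below is the everywhere defined bounded inverse of $T - \lambda$.
  Only real $\lambda$ are considered: the spaces are real, and the complexification of a
  self-adjoint operator has no further spectrum.\<close>

definition resolvent_set :: "('a::real_inner \<times> 'a) set \<Rightarrow> real set" where
  "resolvent_set T = {l. \<exists>R. bounded_linear R \<and>
     (\<forall>h. \<exists>f. (R h, f) \<in> T \<and> f - l *\<^sub>R R h = h) \<and>
     (\<forall>(u, f)\<in>T. R (f - l *\<^sub>R u) = u)}"

definition spectrum_op :: "('a::real_inner \<times> 'a) set \<Rightarrow> real set" where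
  "spectrum_op T = - resolvent_set T"

definition eigenspace :: "('a::real_inner \<times> 'a) set \<Rightarrow> real \<Rightarrow> 'a set" where
  "eigenspace T l = {u. (u, l *\<^sub>R u) \<in> T}"

definition eigenvalue_op :: "('a::real_inner \<times> 'a) set \<Rightarrow> real \<Rightarrow> bool" where
  "eigenvalue_op T l \<longleftrightarrow> (\<exists>u\<in>eigenspace T l. u \<noteq> 0)"

definition discrete_spectrum :: "('a::real_inner \<times> 'a) set \<Rightarrow> bool" where
  "discrete_spectrum T \<longleftrightarrow>
     (\<forall>l\<in>spectrum_op T. eigenvalue_op T l \<and> (\<exists>B. finite B \<and> eigenspace T l \<subseteq> span B)) \<and>
     (\<forall>l. \<not> l islimpt spectrum_op T)"


section \<open>The degenerate operator\<close>

definition abs_continuous_on_ivl :: "real \<Rightarrow> real \<Rightarrow> (real \<Rightarrow> real) \<Rightarrow> bool" where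
  "abs_continuous_on_ivl a b f \<longleftrightarrow>
     (\<forall>e>0. \<exists>d>0. \<forall>I. finite I \<and> (\<forall>(s, t)\<in>I. a \<le> s \<and> s < t \<and> t \<le> b) \<and>
        pairwise (\<lambda>(s, t) (s', t'). disjnt {s<..<t} {s'<..<t'}) I \<and>
        (\<Sum>(s, t)\<in>I. t - s) < d \<longrightarrow> (\<Sum>(s, t)\<in>I. \<bar>f t - f s\<bar>) < e)"

definition flux :: "real \<Rightarrow> (real \<Rightarrow> real) \<Rightarrow> real \<Rightarrow> real" where
  "flux \<beta> v = (\<lambda>x. x powr \<beta> * deriv v x)"

definition degenerate_expr :: "real \<Rightarrow> (real \<Rightarrow> real) \<Rightarrow> real \<Rightarrow> real" where
  "degenerate_expr \<beta> v = (\<lambda>x. - deriv (flux \<beta> v) x)"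

text \<open>The derivatives are taken in the open interval (a function such as $x^{1-\beta}$
  need not be differentiable at $0$); that the flux lies in $C[0,1]$ and its
  derivative in $AC[0,1]$ means that they extend to such functions. For
  $0 < \beta < 2$ the only order $\mu$ with $0 \le \mu \le -[\beta]$ is
  $\mu = 0$, and it occurs exactly for $\beta < 1$.\<close>

definition degenerate_domain :: "real \<Rightarrow> (real \<Rightarrow> real) set" where
  "degenerate_domain \<beta> = {v.
     continuous_on {0..1} v \<and>
     (\<forall>x\<in>{0<..<1}. v differentiable at x) \<and>
     (\<exists>w. continuous_on {0..1} w \<and> (\<forall>x\<in>{0<..<1}. flux \<beta> v x = w x)) \<and>
     (\<forall>x\<in>{0<..<1}. flux \<beta> v differentiable at x) \<and>
     (\<exists>g. abs_continuous_on_ivl 0 1 g \<and> (\<forall>x\<in>{0<..<1}. deriv (flux \<beta> v) x = g x)) \<and>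
     square_integrable (degenerate_expr \<beta> v) \<and>
     (\<beta> < 1 \<longrightarrow> v 0 = 0) \<and> v 1 = 0}"

definition degenerate_operator :: "real \<Rightarrow> (L2 \<times> L2) set" where
  "degenerate_operator \<beta> =
     (\<lambda>v. (abs_L2 v, abs_L2 (degenerate_expr \<beta> v))) ` degenerate_domain \<beta>"

end

theory Submission
  imports Defs
begin

text \<open>
The inverse of the operator is an explicit integral operator.  Integrating
\<open>- (x\<^sup>\<beta> v')' = f\<close> twice and using the boundary conditions gives \<open>v = K f\<close>, where \<open>K\<close>
has the kernel \<open>green \<beta> x y\<close>, the product of the solution of \<open>(x\<^sup>\<beta> u')' = 0\<close> that is
admissible at \<open>0\<close>, taken at \<open>min x y\<close>, and of the one that vanishes at \<open>1\<close>, taken at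
\<open>max x y\<close>.  For \<open>\<beta> > 1\<close> the kernel has a singularity at the origin, but it is always
bounded by a product \<open>\<rho> x * \<rho> y\<close> with \<open>\<rho> x\<close> a multiple of
\<open>x powr (- \<bar>1 - \<beta>\<bar> / 2)\<close>, and \<open>\<rho>\<close> is square integrable because
\<open>\<bar>1 - \<beta>\<bar> < 1\<close>.  Hence \<open>K\<close> is a symmetric Hilbert--Schmidt operator.

The Friedrichs extension is exactly the inverse of \<open>K\<close>
(\<open>friedrichs_extension_degenerate_operator\<close>).  One has \<open>K (A v) = v\<close> on the domain of
\<open>A\<close> (\<open>green_representation\<close>), and every polynomial lies in the range of \<open>A\<close>
(\<open>polynomial_in_range\<close>).  Since polynomials are dense, testing against them shows that the
adjoint of \<open>A\<close> contains nothing but pairs \<open>(K f, f)\<close>; conversely the symmetry of \<open>K\<close>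
puts these pairs into the adjoint, and approximating \<open>f\<close> by polynomials puts \<open>K f\<close> into
the form domain.

It remains to see that the inverse of a symmetric Hilbert--Schmidt operator on a Hilbert space
has discrete spectrum (\<open>discrete_spectrum_inverse_graph\<close>).  If \<open>C\<close> bounds
\<open>\<Sum>\<parallel>K e\<parallel>\<^sup>2\<close> over all finite orthonormal systems, then
at most \<open>L\<^sup>2 * C\<close> orthonormal eigenvectors can belong to eigenvalues of modulus at most \<open>L\<close>;
this gives finite multiplicities and excludes finite accumulation points at once.  That every
spectral value is an eigenvalue is the Fredholm alternative for \<open>1 - l K\<close>: injectivity
yields a lower bound, because \<open>K\<close> is small off a finite-dimensional subspace, and a symmetric
operator that is bounded below is onto.
\<close>

section \<open>Finite orthonormal systems\<close>

definition finite_orthonormal :: "'a::real_inner set \<Rightarrow> bool" where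
  "finite_orthonormal E \<longleftrightarrow> finite E \<and> pairwise orthogonal E \<and> (\<forall>e\<in>E. norm e = 1)"

lemma finite_orthonormal_empty [simp]: "finite_orthonormal {}"
  by (simp add: finite_orthonormal_def)

lemma finite_orthonormal_insert_normalized:
  assumes "finite_orthonormal E" "x \<noteq> 0" "\<And>e. e \<in> E \<Longrightarrow> inner e x = 0"
  shows "finite_orthonormal (insert (sgn x) E)" and "sgn x \<notin> E"
proof -
  have "inner e (sgn x) = 0" if "e \<in> E" for e
    using assms(3)[OF that] by (simp add: sgn_div_norm)
  then show "finite_orthonormal (insert (sgn x) E)"
    using assms by (auto simp: finite_orthonormal_def pairwise_insert orthogonal_def
        norm_sgn inner_commute)
  have "inner (sgn x) x \<noteq> 0"
    using assms(2) by (simp add: sgn_div_norm)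
  then show "sgn x \<notin> E"
    using assms(3) by blast
qed

lemma inner_orthonormal_combination:
  assumes "finite_orthonormal E" "e \<in> E"
  shows "inner e (\<Sum>d\<in>E. c d *\<^sub>R d) = c e"
proof -
  have "inner e (\<Sum>d\<in>E. c d *\<^sub>R d) = (\<Sum>d\<in>E. if d = e then c e else 0)"
    unfolding inner_sum_right
  proof (rule sum.cong[OF refl])
    fix d assume "d \<in> E"
    with assms show "inner e (c d *\<^sub>R d) = (if d = e then c e else 0)"
      by (auto simp: finite_orthonormal_def pairwise_def orthogonal_def norm_eq_1)
  qed
  also have "\<dots> = c e"
    using assms by (simp add: finite_orthonormal_def)
  finally show ?thesis .
qed

definition orthonormal_proj :: "'a::real_inner set \<Rightarrow> 'a \<Rightarrow> 'a" where
  "orthonormal_proj E x = (\<Sum>e\<in>E. inner e x *\<^sub>R e)"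

lemma inner_orthonormal_proj_residual:
  assumes "finite_orthonormal E" "e \<in> E"
  shows "inner e (x - orthonormal_proj E x) = 0"
  using inner_orthonormal_combination[OF assms] by (simp add: inner_diff_right orthonormal_proj_def)

lemma orthonormal_proj_diff:
  "orthonormal_proj E (x - y) = orthonormal_proj E x - orthonormal_proj E y"
  by (simp add: orthonormal_proj_def inner_diff_right scaleR_left_diff_distrib sum_subtractf)

lemma orthonormal_proj_pythagoras:
  assumes "finite_orthonormal E"
  shows "(norm x)\<^sup>2 = (\<Sum>e\<in>E. (inner e x)\<^sup>2) + (norm (x - orthonormal_proj E x))\<^sup>2"
proof -
  define r where "r = x - orthonormal_proj E x"
  have 0: "inner (orthonormal_proj E x) r = 0"
    using inner_orthonormal_proj_residual[OF assms, of _ x]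
    by (auto simp: r_def orthonormal_proj_def[of E x] inner_sum_left intro!: sum.neutral)
  have 1: "inner (orthonormal_proj E x) x = (\<Sum>e\<in>E. (inner e x)\<^sup>2)"
    by (simp add: orthonormal_proj_def inner_sum_left power2_eq_square)
  have "inner x x = inner (orthonormal_proj E x) x + inner r x"
    by (simp add: r_def inner_diff_left)
  moreover have "inner r x = inner r r"
    using 0 by (simp add: r_def inner_diff_left inner_diff_right inner_commute)
  ultimately show ?thesis
    using 1 by (simp add: power2_norm_eq_inner r_def)
qed

lemma bessel_inequality:
  assumes "finite_orthonormal E"
  shows "(\<Sum>e\<in>E. (inner e x)\<^sup>2) \<le> (norm x)\<^sup>2"
  using orthonormal_proj_pythagoras[OF assms, of x] by simp

lemma norm_orthonormal_proj_residual_le: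
  assumes "finite_orthonormal E"
  shows "norm (x - orthonormal_proj E x) \<le> norm x"
proof (rule power2_le_imp_le)
  show "(norm (x - orthonormal_proj E x))\<^sup>2 \<le> (norm x)\<^sup>2"
    using orthonormal_proj_pythagoras[OF assms, of x] by (simp add: sum_nonneg)
qed simp

lemma finite_family_convergent_subsequence:
  fixes c :: "'b \<Rightarrow> nat \<Rightarrow> real"
  assumes "finite E" "\<And>e. e \<in> E \<Longrightarrow> bounded (range (c e))"
  shows "\<exists>r. strict_mono r \<and> (\<forall>e\<in>E. convergent (\<lambda>n. c e (r n)))"
  using assms
proof (induction E rule: finite_induct)
  case empty
  show ?case by (auto intro: strict_mono_id)
next
  case (insert a E)
  then obtain r where r: "strict_mono r" "\<forall>e\<in>E. convergent (\<lambda>n. c e (r n))"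
    by auto
  have "bounded (range (\<lambda>n. c a (r n)))"
    using insert.prems[of a] by (rule bounded_subset) auto
  from bounded_imp_convergent_subsequence[OF this] obtain l s
    where s: "strict_mono s" "((\<lambda>n. c a (r n)) \<circ> s) \<longlonglongrightarrow> l" by blast
  have "convergent (\<lambda>n. c e (r (s n)))" if "e \<in> E" for e
    using r(2) that convergent_subseq_convergent[of "\<lambda>n. c e (r n)" s] s(1) by (auto simp: o_def)
  moreover have "convergent (\<lambda>n. c a (r (s n)))"
    using s(2) by (auto simp: convergent_def o_def)
  ultimately show ?case
    using strict_mono_o[OF r(1) s(1)] by (intro exI[of _ "r \<circ> s"]) (auto simp: o_def)
qed

section \<open>Symmetric Hilbert--Schmidt operators\<close>

text \<open>The Hilbert--Schmidt condition is expressed through finite orthonormal systems only, which makes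
it meaningful for a space of any dimension; \<open>C\<close> bounds the square of the Hilbert--Schmidt
norm.\<close>

locale symmetric_hilbert_schmidt =
  fixes K :: "'a::{real_inner,complete_space} \<Rightarrow> 'a" and C :: real
  assumes linear: "linear K"
    and symmetric: "inner (K u) v = inner u (K v)"
    and hilbert_schmidt: "finite_orthonormal E \<Longrightarrow> (\<Sum>e\<in>E. (norm (K e))\<^sup>2) \<le> C"
begin

lemmas K_simps = linear_add[OF linear] linear_diff[OF linear] linear_scale[OF linear]
  linear_0[OF linear]

lemma norm_K_le: "norm (K x) \<le> sqrt C * norm x"
proof (cases "x = 0")
  case True
  then show ?thesis by (simp add: K_simps)
next
  case False
  have "(norm (K (sgn x)))\<^sup>2 \<le> C"
    using hilbert_schmidt[OF finite_orthonormal_insert_normalized(1)[OF finite_orthonormal_empty False]]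
    by simp
  then have "norm (K (sgn x)) \<le> sqrt C"
    by (simp add: real_le_rsqrt)
  then show ?thesis
    using False by (simp add: sgn_div_norm K_simps field_simps)
qed

lemma bounded_linear_K: "bounded_linear K"
  using linear by (intro bounded_linear_intro[where K="sqrt C"])
    (auto simp: K_simps norm_K_le mult.commute)

text \<open>A finite system whose sum is within \<open>\<epsilon>\<^sup>2\<close> of the supremum works: a unit vector orthogonal
to it may be added to the system, and this raises the sum by at most \<open>\<epsilon>\<^sup>2\<close>.  This is the
form in which the compactness of \<open>K\<close> enters below.\<close>

lemma small_off_finite_subspace:
  assumes "\<epsilon> > 0"
  obtains E where "finite_orthonormal E"
    "\<And>x. (\<And>e. e \<in> E \<Longrightarrow> inner e x = 0) \<Longrightarrow> norm (K x) \<le> \<epsilon> * norm x"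
proof -
  define S where "S = (\<lambda>E. \<Sum>e\<in>E. (norm (K e))\<^sup>2) ` Collect finite_orthonormal"
  have ne: "S \<noteq> {}"
    unfolding S_def using finite_orthonormal_empty by blast
  have bdd: "bdd_above S"
    unfolding S_def using hilbert_schmidt by (auto intro!: bdd_aboveI2[of _ _ C])
  have "Sup S - \<epsilon>\<^sup>2 < Sup S"
    using assms by simp
  then obtain E where E: "finite_orthonormal E" "Sup S - \<epsilon>\<^sup>2 < (\<Sum>e\<in>E. (norm (K e))\<^sup>2)"
    using less_cSupD[OF ne] unfolding S_def by blast
  have "norm (K x) \<le> \<epsilon> * norm x" if orth: "\<And>e. e \<in> E \<Longrightarrow> inner e x = 0" for x
  proof (cases "x = 0")
    case False
    note ins = finite_orthonormal_insert_normalized[OF E(1) False orth]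
    have "(\<Sum>e\<in>insert (sgn x) E. (norm (K e))\<^sup>2) \<le> Sup S"
      using ins(1) by (intro cSup_upper bdd) (auto simp: S_def)
    then have "(norm (K (sgn x)))\<^sup>2 \<le> \<epsilon>\<^sup>2"
      using E ins by (simp add: finite_orthonormal_def)
    then have "norm (K (sgn x)) \<le> \<epsilon>"
      using assms by (simp add: power2_le_iff_abs_le)
    then show ?thesis
      using False by (simp add: sgn_div_norm K_simps field_simps)
  qed (simp add: K_simps)
  with E(1) show thesis by (rule that)
qed

text \<open>Suppose that unit vectors \<open>x n\<close> satisfy \<open>x n - l K (x n) \<longlonglongrightarrow> 0\<close>.  On the orthogonal
complement of a suitable finite system \<open>l K\<close> has norm at most one half, so that
\<open>\<parallel>x m - x n\<parallel>\<close> is controlled by the images and by the projections to the finite system; the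
latter converge along a subsequence.  That subsequence is then Cauchy, and its limit is a unit
vector in the kernel.\<close>

lemma bounded_below_if_injective:
  assumes inj: "\<And>x. x = l *\<^sub>R K x \<Longrightarrow> x = 0"
  obtains c where "c > 0" "\<And>x. c * norm x \<le> norm (x - l *\<^sub>R K x)"
proof (rule ccontr)
  assume "\<not> thesis"
  then have "\<exists>x. norm (x - l *\<^sub>R K x) < inverse (real (Suc n)) * norm x" for n
    using that[of "inverse (real (Suc n))"] by (meson inverse_positive_iff_positive not_le of_nat_0_less_iff zero_less_Suc)
  then obtain z where z: "\<And>n. norm (z n - l *\<^sub>R K (z n)) < inverse (real (Suc n)) * norm (z n)"
    by metis
  define M where "M x = x - l *\<^sub>R K x" for x
  have M_diff: "M (a - b) = M a - M b" for a b
    by (simp add: M_def K_simps algebra_simps)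
  define x where "x n = sgn (z n)" for n
  have z0: "z n \<noteq> 0" for n
    using z[of n] by (auto simp: K_simps)
  have x1: "norm (x n) = 1" for n
    using z0 by (simp add: x_def norm_sgn)
  have "M (x n) = inverse (norm (z n)) *\<^sub>R M (z n)" for n
    by (simp add: M_def x_def sgn_div_norm K_simps scaleR_right_diff_distrib scaleR_left_commute)
  then have "norm (M (x n)) = norm (M (z n)) / norm (z n)" for n
    by (simp add: divide_inverse_commute)
  moreover have "norm (M (z n)) / norm (z n) < inverse (real (Suc n))" for n
    using z[of n] z0[of n] pos_divide_less_eq[of "norm (z n)" "norm (M (z n))"] by (simp add: M_def)
  ultimately have "norm (M (x n)) < inverse (real (Suc n))" for n
    by simp
  then have Mx0: "(\<lambda>n. M (x n)) \<longlonglongrightarrow> 0"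
    by (intro Lim_null_comparison[OF _ LIMSEQ_inverse_real_of_nat])
       (auto intro!: always_eventually less_imp_le)
  obtain E where E: "finite_orthonormal E"
    and small: "\<And>x. (\<And>e. e \<in> E \<Longrightarrow> inner e x = 0) \<Longrightarrow> norm (K x) \<le> (1 / (2 * (\<bar>l\<bar> + 1))) * norm x"
  proof (rule small_off_finite_subspace)
    show "0 < 1 / (2 * (\<bar>l\<bar> + 1))" by simp
  qed blast
  have "bounded (range (\<lambda>n. inner e (x n)))" if "e \<in> E" for e
  proof (rule boundedI)
    fix y assume "y \<in> range (\<lambda>n. inner e (x n))"
    then obtain n where "y = inner e (x n)" by blast
    then show "norm y \<le> norm e"
      using Cauchy_Schwarz_ineq2[of e "x n"] x1[of n] by simp
  qed
  then obtain r where r: "strict_mono r" "\<And>e. e \<in> E \<Longrightarrow> convergent (\<lambda>n. inner e (x (r n)))"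
    using finite_family_convergent_subsequence[of E "\<lambda>e n. inner e (x n)"] E
    by (auto simp: finite_orthonormal_def)
  define p where "p n = orthonormal_proj E (x (r n))" for n
  have "convergent p"
    unfolding p_def orthonormal_proj_def
  proof (rule convergent_sum)
    fix e assume "e \<in> E"
    then obtain a where "(\<lambda>n. inner e (x (r n))) \<longlonglongrightarrow> a"
      using r(2) unfolding convergent_def by blast
    then have "(\<lambda>n. inner e (x (r n)) *\<^sub>R e) \<longlonglongrightarrow> a *\<^sub>R e"
      by (intro tendsto_intros)
    then show "convergent (\<lambda>n. inner e (x (r n)) *\<^sub>R e)"
      by (rule convergentI)
  qed
  then have p: "Cauchy p"
    by (rule convergent_Cauchy)
  have Mxr: "(\<lambda>n. M (x (r n))) \<longlonglongrightarrow> 0"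
    using LIMSEQ_subseq_LIMSEQ[OF Mx0 r(1)] by (simp add: o_def)
  have le: "norm (x (r m) - x (r n)) \<le> 2 * norm (M (x (r m)) - M (x (r n)))
      + 2 * \<bar>l\<bar> * sqrt C * norm (p m - p n)" for m n
  proof -
    define y where "y = x (r m) - x (r n)"
    define q where "q = orthonormal_proj E y"
    have q: "q = p m - p n"
      by (simp add: q_def y_def p_def orthonormal_proj_diff)
    have "\<bar>l\<bar> * norm (K (y - q)) \<le> \<bar>l\<bar> * ((1 / (2 * (\<bar>l\<bar> + 1))) * norm (y - q))"
      using small[of "y - q"] inner_orthonormal_proj_residual[OF E] q_def
      by (intro mult_left_mono) auto
    also have "\<dots> = (\<bar>l\<bar> / (2 * (\<bar>l\<bar> + 1))) * norm (y - q)"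
      by simp
    also have "\<dots> \<le> (1 / 2) * norm y"
      using norm_orthonormal_proj_residual_le[OF E, of y] q_def
      by (intro mult_mono) (auto simp: field_simps)
    finally have 1: "\<bar>l\<bar> * norm (K (y - q)) \<le> norm y / 2" by simp
    have 2: "\<bar>l\<bar> * norm (K q) \<le> \<bar>l\<bar> * (sqrt C * norm q)"
      by (intro mult_left_mono norm_K_le) auto
    have "y = M y + l *\<^sub>R K (y - q) + l *\<^sub>R K q"
      by (simp add: M_def K_simps algebra_simps)
    then have "norm y \<le> norm (M y) + norm (l *\<^sub>R K (y - q)) + norm (l *\<^sub>R K q)"
      by (metis norm_triangle_mono norm_triangle_ineq order_refl)
    with 1 2 have "norm y \<le> 2 * norm (M y) + 2 * \<bar>l\<bar> * sqrt C * norm q"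
      by simp
    then show ?thesis
      by (simp add: y_def q M_diff)
  qed
  have "Cauchy (\<lambda>n. x (r n))"
  proof (rule metric_CauchyI)
    fix e :: real assume "e > 0"
    define L where "L = 2 * \<bar>l\<bar> * sqrt C + 1"
    have C0: "C \<ge> 0"
      using hilbert_schmidt[OF finite_orthonormal_empty] by simp
    then have L: "L > 0"
      unfolding L_def by (intro add_nonneg_pos mult_nonneg_nonneg) auto
    from p \<open>e > 0\<close> L obtain N1 where N1: "\<And>m n. m \<ge> N1 \<Longrightarrow> n \<ge> N1 \<Longrightarrow> norm (p m - p n) < e / (2 * L)"
      by (meson CauchyD divide_pos_pos mult_pos_pos zero_less_numeral)
    have "Cauchy (\<lambda>n. M (x (r n)))"
      using Mxr by (rule LIMSEQ_imp_Cauchy)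
    then obtain N2 where N2: "\<And>m n. m \<ge> N2 \<Longrightarrow> n \<ge> N2 \<Longrightarrow> norm (M (x (r m)) - M (x (r n))) < e / 4"
      using \<open>e > 0\<close> by (meson CauchyD divide_pos_pos zero_less_numeral)
    have "dist (x (r m)) (x (r n)) < e" if "m \<ge> max N1 N2" "n \<ge> max N1 N2" for m n
    proof -
      have "2 * \<bar>l\<bar> * sqrt C * norm (p m - p n) \<le> L * norm (p m - p n)"
        by (intro mult_right_mono) (auto simp: L_def)
      also have "\<dots> \<le> L * (e / (2 * L))"
        using N1[of m n] that L by (intro mult_left_mono) auto
      also have "\<dots> = e / 2" using L by simp
      finally show ?thesis
        using le[of m n] N2[of m n] that by (simp add: dist_norm)
    qed
    then show "\<exists>M. \<forall>m\<ge>M. \<forall>n\<ge>M. dist (x (r m)) (x (r n)) < e" by blast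
  qed
  then obtain u where u: "(\<lambda>n. x (r n)) \<longlonglongrightarrow> u"
    using Cauchy_convergent convergent_def by blast
  have "(\<lambda>n. M (x (r n))) \<longlonglongrightarrow> M u"
    unfolding M_def
    by (intro tendsto_intros u bounded_linear.tendsto[OF bounded_linear_K])
  then have "M u = 0"
    using Mxr LIMSEQ_unique by blast
  then have "u = 0"
    using inj[of u] by (simp add: M_def)
  moreover have "norm u = 1"
    using tendsto_norm[OF u] x1 by (simp add: LIMSEQ_const_iff)
  ultimately show False by simp
qed


text \<open>For a symmetric \<open>M\<close> that is bounded below, \<open>M\<^sup>2\<close> is positive and bounded away from zero.
Therefore the Richardson iteration \<open>x \<mapsto> x - t (M (M x) - h)\<close> is a contraction for small
\<open>t > 0\<close>, and its fixed point solves \<open>M (M x) = h\<close>.\<close>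

lemma surjective_if_bounded_below:
  assumes c: "c > 0" "\<And>x. c * norm x \<le> norm (x - l *\<^sub>R K x)"
  shows "\<exists>x. x - l *\<^sub>R K x = h"
proof -
  define M where "M x = x - l *\<^sub>R K x" for x
  have M_simps: "M (a - b) = M a - M b" "M (r *\<^sub>R a) = r *\<^sub>R M a" for a b r
    by (simp_all add: M_def K_simps algebra_simps)
  have M_sym: "inner (M a) b = inner a (M b)" for a b
    by (simp add: M_def inner_diff_left inner_diff_right symmetric)
  define B where "B = 1 + \<bar>l\<bar> * sqrt C"
  have "C \<ge> 0"
    using hilbert_schmidt[OF finite_orthonormal_empty] by simp
  then have B: "B > 0"
    unfolding B_def by (intro add_pos_nonneg mult_nonneg_nonneg) auto
  have norm_M: "norm (M x) \<le> B * norm x" for x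
  proof -
    have "norm (M x) \<le> norm x + \<bar>l\<bar> * norm (K x)"
      unfolding M_def using norm_triangle_ineq4[of x "l *\<^sub>R K x"] by simp
    also have "\<dots> \<le> norm x + \<bar>l\<bar> * (sqrt C * norm x)"
      by (intro add_left_mono mult_left_mono norm_K_le) auto
    finally show ?thesis by (simp add: B_def algebra_simps)
  qed
  define t where "t = 1 / B\<^sup>2"
  \<comment> \<open>On the zero space \<open>c\<close> may exceed \<open>B\<close>; the maximum keeps the factor nonnegative there.\<close>
  define q where "q = max 0 (1 - t * c\<^sup>2)"
  have t: "t > 0" "t * B\<^sup>2 = 1"
    using B by (simp_all add: t_def)
  have contract: "(norm (d - t *\<^sub>R M (M d)))\<^sup>2 \<le> q * (norm d)\<^sup>2" for d
  proof -
    have "inner d (M (M d)) = (norm (M d))\<^sup>2"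
      by (simp add: M_sym[symmetric] power2_norm_eq_inner)
    then have "(norm (d - t *\<^sub>R M (M d)))\<^sup>2
        = (norm d)\<^sup>2 - 2 * t * (norm (M d))\<^sup>2 + t\<^sup>2 * (norm (M (M d)))\<^sup>2"
      unfolding power2_norm_eq_inner
      by (simp add: inner_diff_left inner_diff_right inner_commute power2_eq_square algebra_simps)
    also have "t\<^sup>2 * (norm (M (M d)))\<^sup>2 \<le> t\<^sup>2 * (B * norm (M d))\<^sup>2"
      by (intro mult_left_mono power_mono norm_M) auto
    also have "t\<^sup>2 * (B * norm (M d))\<^sup>2 = t * (t * B\<^sup>2) * (norm (M d))\<^sup>2"
      by (simp add: power2_eq_square algebra_simps)
    also have "\<dots> = t * (norm (M d))\<^sup>2"
      using t by simp
    finally have "(norm (d - t *\<^sub>R M (M d)))\<^sup>2 \<le> (norm d)\<^sup>2 - t * (norm (M d))\<^sup>2" by simp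
    moreover have "t * (c * norm d)\<^sup>2 \<le> t * (norm (M d))\<^sup>2"
      using c t by (intro mult_left_mono power_mono) (auto simp: M_def)
    moreover have "(1 - t * c\<^sup>2) * (norm d)\<^sup>2 \<le> q * (norm d)\<^sup>2"
      by (intro mult_right_mono) (auto simp: q_def)
    ultimately show ?thesis
      by (simp add: algebra_simps power_mult_distrib)
  qed
  define F where "F x = x - t *\<^sub>R (M (M x) - h)" for x
  have "\<exists>!x. F x = x"
  proof (rule banach_fix_type[where c = "sqrt q"])
    show "0 \<le> sqrt q" by (simp add: q_def)
    show "sqrt q < 1" using t c by (simp add: q_def)
    show "\<forall>x y. dist (F x) (F y) \<le> sqrt q * dist x y"
    proof (intro allI)
      fix x y
      have "F x - F y = (x - y) - t *\<^sub>R M (M (x - y))"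
        by (simp add: F_def M_simps algebra_simps)
      then have "(norm (F x - F y))\<^sup>2 \<le> (sqrt q * norm (x - y))\<^sup>2"
        using contract[of "x - y"] by (simp add: power_mult_distrib q_def)
      then show "dist (F x) (F y) \<le> sqrt q * dist x y"
        unfolding dist_norm by (rule power2_le_imp_le) (simp add: q_def)
    qed
  qed
  then obtain x where "F x = x" by blast
  then have "M (M x) = h"
    using t by (simp add: F_def)
  then show ?thesis
    unfolding M_def by blast
qed

lemma resolvent_if_injective:
  assumes inj: "\<And>x. x = l *\<^sub>R K x \<Longrightarrow> x = 0"
  shows "l \<in> resolvent_set (range (\<lambda>f. (K f, f)))"
proof -
  obtain c where c: "c > 0" "\<And>x. c * norm x \<le> norm (x - l *\<^sub>R K x)"
    using bounded_below_if_injective[OF inj] by blast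
  define M where "M x = x - l *\<^sub>R K x" for x
  have M_simps: "M (a + b) = M a + M b" "M (a - b) = M a - M b" "M (r *\<^sub>R a) = r *\<^sub>R M a" for a b r
    by (simp_all add: M_def K_simps algebra_simps)
  have "inj M"
  proof (rule injI)
    fix a b assume "M a = M b"
    then have "M (a - b) = 0" by (simp add: M_simps)
    then show "a = b" using inj[of "a - b"] by (simp add: M_def)
  qed
  moreover have "surj M"
    using surjective_if_bounded_below[OF c] unfolding M_def surj_def by metis
  ultimately have M_inv: "M (inv M h) = h" "inv M (M x) = x" for h x
    by (simp_all add: surj_f_inv_f inv_f_f)
  have "bounded_linear (inv M)"
  proof (rule bounded_linear_intro[where K = "1 / c"])
    show "inv M (a + b) = inv M a + inv M b" for a b
      by (metis M_inv M_simps(1))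
    show "inv M (r *\<^sub>R a) = r *\<^sub>R inv M a" for r a
      by (metis M_inv M_simps(3))
    show "norm (inv M h) \<le> norm h * (1 / c)" for h
    proof -
      have "c * norm (inv M h) \<le> norm (M (inv M h))"
        using c(2) by (simp add: M_def)
      then show ?thesis
        using c(1) by (simp add: M_inv field_simps)
    qed
  qed
  then have "bounded_linear (\<lambda>h. K (inv M h))"
    using bounded_linear_compose[OF bounded_linear_K] by blast
  moreover have "\<exists>f. (K (inv M h), f) \<in> range (\<lambda>f. (K f, f)) \<and> f - l *\<^sub>R K (inv M h) = h" for h
    using M_inv(1)[of h] by (intro exI[of _ "inv M h"]) (auto simp: M_def)
  moreover have "\<forall>(u, f)\<in>range (\<lambda>f. (K f, f)). K (inv M (f - l *\<^sub>R u)) = u"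
    using M_inv(2) by (auto simp: M_def)
  ultimately show ?thesis
    unfolding resolvent_set_def by blast
qed

lemma eigenspace_inverse_graph:
  "eigenspace (range (\<lambda>f. (K f, f))) l = {u. u = l *\<^sub>R K u}"
proof -
  have "(u, l *\<^sub>R u) \<in> range (\<lambda>f. (K f, f)) \<longleftrightarrow> u = K (l *\<^sub>R u)" for u
    by auto
  then show ?thesis
    by (simp add: eigenspace_def K_simps)
qed

lemma spectrum_inverse_graph_imp_eigenvalue:
  assumes "l \<in> spectrum_op (range (\<lambda>f. (K f, f)))"
  obtains u where "u = l *\<^sub>R K u" "norm u = 1"
proof -
  obtain x where x: "x = l *\<^sub>R K x" "x \<noteq> 0"
    using resolvent_if_injective[of l] assms unfolding spectrum_op_def by blast
  show thesis
  proof (rule that[of "sgn x"])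
    show "sgn x = l *\<^sub>R K (sgn x)"
    proof -
      have "inverse (norm x) *\<^sub>R x = inverse (norm x) *\<^sub>R (l *\<^sub>R K x)"
        using x(1) by (rule arg_cong)
      then show ?thesis
        unfolding sgn_div_norm K_simps by (rule trans[OF _ scaleR_left_commute])
    qed
    show "norm (sgn x) = 1"
      using x(2) by (simp add: norm_sgn)
  qed
qed

text \<open>An eigenvector \<open>e = m K e\<close> of length one contributes \<open>1 / m\<^sup>2 \<ge> 1 / L\<^sup>2\<close> to the
Hilbert--Schmidt sum.\<close>

lemma card_orthonormal_eigenvectors_le:
  assumes E: "finite_orthonormal E"
    and eig: "\<And>e. e \<in> E \<Longrightarrow> \<exists>m. \<bar>m\<bar> \<le> L \<and> e = m *\<^sub>R K e"
  shows "real (card E) \<le> L\<^sup>2 * C"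
proof -
  have "real (card E) = (\<Sum>e\<in>E. (norm e)\<^sup>2)"
    using E by (simp add: finite_orthonormal_def)
  also have "\<dots> \<le> (\<Sum>e\<in>E. L\<^sup>2 * (norm (K e))\<^sup>2)"
  proof (rule sum_mono)
    fix e assume "e \<in> E"
    then obtain m where m: "\<bar>m\<bar> \<le> L" "e = m *\<^sub>R K e" using eig by blast
    have "norm e = \<bar>m\<bar> * norm (K e)"
      using arg_cong[OF m(2), of norm] by simp
    also have "\<dots> \<le> L * norm (K e)"
      using m(1) by (rule mult_right_mono) simp
    finally have "(norm e)\<^sup>2 \<le> (L * norm (K e))\<^sup>2"
      by (rule power_mono) simp
    then show "(norm e)\<^sup>2 \<le> L\<^sup>2 * (norm (K e))\<^sup>2"
      by (simp add: power_mult_distrib)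
  qed
  also have "\<dots> \<le> L\<^sup>2 * C"
    using hilbert_schmidt[OF E] by (simp flip: sum_distrib_left add: mult_left_mono)
  finally show ?thesis .
qed

text \<open>An orthonormal system of maximal cardinality in the eigenspace spans it, since otherwise the
normalised residual of a projection could be added.\<close>

lemma eigenspace_finite_dimensional:
  "\<exists>B. finite B \<and> {u. u = l *\<^sub>R K u} \<subseteq> span B"
proof -
  define P where "P E \<longleftrightarrow> finite_orthonormal E \<and> E \<subseteq> {u. u = l *\<^sub>R K u}" for E
  have "card E \<le> nat \<lceil>\<bar>l\<bar>\<^sup>2 * C\<rceil>" if "P E" for E
  proof -
    have "real (card E) \<le> \<bar>l\<bar>\<^sup>2 * C"
      using that unfolding P_def by (intro card_orthonormal_eigenvectors_le) blast+
    then show ?thesis by linarith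
  qed
  moreover have "P {}"
    by (simp add: P_def)
  ultimately obtain E where E: "P E" and E_max: "\<And>E'. P E' \<Longrightarrow> card E' \<le> card E"
    using ex_has_greatest_nat[of P "{}" card "Suc (nat \<lceil>\<bar>l\<bar>\<^sup>2 * C\<rceil>)"]
    unfolding less_Suc_eq_le by metis
  have on: "finite_orthonormal E" and eigE: "\<And>e. e \<in> E \<Longrightarrow> e = l *\<^sub>R K e"
    using E by (auto simp: P_def)
  have subsp: "subspace {u. u = l *\<^sub>R K u}"
  proof (rule subspaceI)
    fix x y assume "x \<in> {u. u = l *\<^sub>R K u}" "y \<in> {u. u = l *\<^sub>R K u}"
    then have "x + y = l *\<^sub>R K x + l *\<^sub>R K y" by auto
    then show "x + y \<in> {u. u = l *\<^sub>R K u}"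
      unfolding mem_Collect_eq K_simps scaleR_add_right .
  next
    fix c x assume "x \<in> {u. u = l *\<^sub>R K u}"
    then have "c *\<^sub>R x = c *\<^sub>R (l *\<^sub>R K x)" by auto
    then show "c *\<^sub>R x \<in> {u. u = l *\<^sub>R K u}"
      unfolding mem_Collect_eq K_simps by (rule trans[OF _ scaleR_left_commute])
  qed (simp add: K_simps)
  have "u \<in> span E" if u: "u = l *\<^sub>R K u" for u
  proof (rule ccontr)
    assume "u \<notin> span E"
    moreover have "orthonormal_proj E u \<in> span E"
      unfolding orthonormal_proj_def by (intro span_sum span_scale span_base)
    ultimately have ne: "u - orthonormal_proj E u \<noteq> 0" by auto
    have "orthonormal_proj E u \<in> {u. u = l *\<^sub>R K u}"
      unfolding orthonormal_proj_def using eigE by (intro subspace_sum subspace_scale subsp) blast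
    then have "u - orthonormal_proj E u \<in> {u. u = l *\<^sub>R K u}"
      using u by (intro subspace_diff subsp) auto
    then have "sgn (u - orthonormal_proj E u) \<in> {u. u = l *\<^sub>R K u}"
      unfolding sgn_div_norm by (intro subspace_scale subsp)
    moreover note ins = finite_orthonormal_insert_normalized[OF on ne inner_orthonormal_proj_residual[OF on]]
    ultimately have "P (insert (sgn (u - orthonormal_proj E u)) E)"
      using E by (auto simp: P_def)
    from E_max[OF this] show False
      using ins(2) on by (simp add: finite_orthonormal_def)
  qed
  with on show ?thesis
    unfolding finite_orthonormal_def by blast
qed

lemma eigenvectors_orthogonal:
  assumes "u = l *\<^sub>R K u" "v = m *\<^sub>R K v" "l \<noteq> m"
  shows "inner u v = 0"
proof -
  have "inner u v = l * inner (K u) v" using arg_cong[OF assms(1), of "\<lambda>w. inner w v"] by simp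
  then have 1: "inner u v = l * inner u (K v)" by (simp only: symmetric)
  have 2: "inner u v = m * inner u (K v)" using arg_cong[OF assms(2), of "\<lambda>w. inner u w"] by simp
  have "l * inner u (K v) = m * inner u (K v)"
    using 1 2 by (rule trans[OF sym])
  then have "inner u (K v) = 0"
    using assms(3) by simp
  with 1 show ?thesis by simp
qed

text \<open>Eigenvectors for distinct eigenvalues are orthogonal, so that the bound on orthonormal systems
of eigenvectors is also a bound on the number of eigenvalues.\<close>

lemma finite_spectrum_in_bounded_interval:
  "finite (spectrum_op (range (\<lambda>f. (K f, f))) \<inter> {l. \<bar>l\<bar> \<le> L})" (is "finite ?S")
proof (rule ccontr)
  assume "infinite ?S"
  then obtain S where S: "S \<subseteq> ?S" "finite S" "card S = Suc (nat \<lceil>L\<^sup>2 * C\<rceil>)"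
    using infinite_arbitrarily_large by blast
  have "\<exists>u. u = l *\<^sub>R K u \<and> norm u = 1" if "l \<in> S" for l
    using spectrum_inverse_graph_imp_eigenvalue[of l] that S(1) by blast
  then obtain e where e: "\<And>l. l \<in> S \<Longrightarrow> e l = l *\<^sub>R K (e l)" "\<And>l. l \<in> S \<Longrightarrow> norm (e l) = 1"
    by metis
  have orth: "inner (e l) (e m) = 0" if "l \<in> S" "m \<in> S" "l \<noteq> m" for l m
    using eigenvectors_orthogonal e(1) that by blast
  have "inj_on e S"
  proof (rule inj_onI, rule ccontr)
    fix l m assume lm: "l \<in> S" "m \<in> S" "e l = e m" "l \<noteq> m"
    then show False
      using orth[of l m] e(2)[of m] by (simp add: norm_eq_1)
  qed
  have "finite_orthonormal (e ` S)"
    using S(2) e(2) orth by (auto simp: finite_orthonormal_def pairwise_def orthogonal_def)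
  moreover have "\<exists>m. \<bar>m\<bar> \<le> L \<and> u = m *\<^sub>R K u" if u: "u \<in> e ` S" for u
    using u e(1) S(1) by blast
  ultimately have "real (card (e ` S)) \<le> L\<^sup>2 * C"
    by (rule card_orthonormal_eigenvectors_le)
  then show False
    using S(3) card_image[OF \<open>inj_on e S\<close>] by linarith
qed

theorem discrete_spectrum_inverse_graph:
  "discrete_spectrum (range (\<lambda>f. (K f, f)))" (is "discrete_spectrum ?T")
  unfolding discrete_spectrum_def
proof (intro conjI ballI allI)
  fix l assume l: "l \<in> spectrum_op ?T"
  then obtain u where u: "u = l *\<^sub>R K u" "norm u = 1"
    by (rule spectrum_inverse_graph_imp_eigenvalue)
  then show "eigenvalue_op ?T l"
    unfolding eigenvalue_op_def eigenspace_inverse_graph by (intro bexI[of _ u]) auto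
  show "\<exists>B. finite B \<and> eigenspace ?T l \<subseteq> span B"
    unfolding eigenspace_inverse_graph by (rule eigenspace_finite_dimensional)
next
  fix l
  show "\<not> l islimpt spectrum_op ?T"
  proof
    assume "l islimpt spectrum_op ?T"
    then have "infinite (spectrum_op ?T \<inter> ball l 1)"
      unfolding islimpt_eq_infinite_ball by simp
    moreover have "spectrum_op ?T \<inter> ball l 1 \<subseteq> spectrum_op ?T \<inter> {m. \<bar>m\<bar> \<le> \<bar>l\<bar> + 1}"
      by (auto simp: dist_real_def)
    ultimately show False
      using finite_spectrum_in_bounded_interval finite_subset by blast
  qed
qed

end

section \<open>Completeness of $L^2(0,1)$ and density of the polynomials\<close>

lemma AE_unit_ivl_iff:
  "(AE x in unit_ivl_measure. P x) \<longleftrightarrow> (AE x in lebesgue. x \<in> {0<..<1} \<longrightarrow> P x)"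
  by (rule AE_restrict_space_iff) auto

lemma AE_unit_ivl_I: "(\<And>x. 0 < x \<Longrightarrow> x < 1 \<Longrightarrow> P x) \<Longrightarrow> AE x in unit_ivl_measure. P x"
  by (auto simp: AE_unit_ivl_iff)

interpretation unit_ivl: finite_measure unit_ivl_measure
  by (rule finite_measure_lebesgue_on) simp

interpretation unit_square: pair_sigma_finite unit_ivl_measure unit_ivl_measure ..

lemma L2_eq_refl_iff: "L2_eq f f \<longleftrightarrow> square_integrable f"
  by (auto simp: L2_eq_def)

lemma L2_representative:
  obtains f where "square_integrable f" "u = abs_L2 f"
proof -
  have "\<exists>f. square_integrable f \<and> u = abs_L2 f"
    by (induction u rule: L2.abs_induct) (auto simp: L2_eq_def)
  with that show thesis by blast
qed

lemma abs_L2_eqI: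
  assumes "square_integrable f" "square_integrable g" "AE x in unit_ivl_measure. f x = g x"
  shows "abs_L2 f = abs_L2 g"
  using Quotient_rel_abs[OF Quotient_L2] assms by (simp add: L2_eq_def)

lemma
  assumes "square_integrable f" "square_integrable g"
  shows abs_L2_add: "abs_L2 f + abs_L2 g = abs_L2 (\<lambda>x. f x + g x)"
    and abs_L2_diff: "abs_L2 f - abs_L2 g = abs_L2 (\<lambda>x. f x - g x)"
    and abs_L2_scale: "c *\<^sub>R abs_L2 f = abs_L2 (\<lambda>x. c * f x)"
    and inner_abs_L2: "inner (abs_L2 f) (abs_L2 g) = (LINT x|unit_ivl_measure. f x * g x)"
  using assms plus_L2.abs_eq[of f g] minus_L2.abs_eq[of f g] scaleR_L2.abs_eq[of f c]
    inner_L2.abs_eq[of f g]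
  by (auto simp: L2_eq_refl_iff)

lemma norm_abs_L2:
  assumes "square_integrable f"
  shows "(norm (abs_L2 f))\<^sup>2 = (LINT x|unit_ivl_measure. (f x)\<^sup>2)"
  using inner_abs_L2[OF assms assms] unfolding power2_norm_eq_inner by (simp add: power2_eq_square)

lemma square_integrable_bounded:
  assumes "f \<in> borel_measurable unit_ivl_measure" "\<And>x. 0 < x \<Longrightarrow> x < 1 \<Longrightarrow> \<bar>f x\<bar> \<le> B"
  shows "square_integrable f"
  unfolding square_integrable_def
proof
  show "integrable unit_ivl_measure (\<lambda>x. (f x)\<^sup>2)"
  proof (rule unit_ivl.integrable_const_bound)
    show "AE x in unit_ivl_measure. norm ((f x)\<^sup>2) \<le> B\<^sup>2"
      using assms(2) by (intro AE_unit_ivl_I) (auto simp: power2_abs intro!: power2_le_iff_abs_le[THEN iffD2] order_trans[OF abs_ge_zero])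
  qed (use assms(1) in measurable)
qed (fact assms(1))

lemma square_integrable_continuous:
  assumes "continuous_on {0..1} f"
  shows "square_integrable f"
proof -
  have "compact (f ` {0..1})"
    using assms by (intro compact_continuous_image) auto
  then have "bounded (f ` {0..1})"
    by (rule compact_imp_bounded)
  then obtain B where B: "\<And>x. x \<in> {0..1} \<Longrightarrow> \<bar>f x\<bar> \<le> B"
    unfolding bounded_real by blast
  have "continuous_on {0<..<1} f"
    using assms by (rule continuous_on_subset) auto
  then show ?thesis
    using B by (intro square_integrable_bounded[of _ B] continuous_imp_measurable_on_sets_lebesgue) auto
qed

lemma square_integrable_dominated:
  assumes "f \<in> borel_measurable unit_ivl_measure" "square_integrable h"
    and "AE x in unit_ivl_measure. \<bar>f x\<bar> \<le> h x"
  shows "square_integrable f"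
  unfolding square_integrable_def
proof
  show "integrable unit_ivl_measure (\<lambda>x. (f x)\<^sup>2)"
  proof (rule Bochner_Integration.integrable_bound)
    show "integrable unit_ivl_measure (\<lambda>x. (h x)\<^sup>2)"
      using assms(2) by (simp add: square_integrable_def)
    show "AE x in unit_ivl_measure. norm ((f x)\<^sup>2) \<le> norm ((h x)\<^sup>2)"
      using assms(3) by eventually_elim (auto simp: abs_le_square_iff[symmetric])
  qed (use assms(1) in measurable)
qed (fact assms(1))

text \<open>The Riesz--Fischer theorem.  Along a subsequence with rapidly decreasing differences the
representatives converge almost everywhere, and Fatou's lemma identifies the limit as the
limit in the mean of the whole sequence.\<close>

instance L2 :: complete_space
proof
  fix X :: "nat \<Rightarrow> L2"
  assume X: "Cauchy X"
  have "\<exists>f. square_integrable f \<and> X n = abs_L2 f" for n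
    using L2_representative by blast
  then obtain f where f: "\<And>n. square_integrable (f n)" and X_f: "\<And>n. X n = abs_L2 (f n)"
    by metis
  have [measurable]: "f n \<in> borel_measurable unit_ivl_measure" for n
    using f by (simp add: square_integrable_def)
  have intd: "integrable unit_ivl_measure (\<lambda>x. (f m x - f n x)\<^sup>2)" for m n
    using square_integrable_diff[OF f f] by (simp add: square_integrable_def)
  have norm_X: "(norm (X m - X n))\<^sup>2 = (LINT x|unit_ivl_measure. (f m x - f n x)\<^sup>2)" for m n
    using f by (simp add: X_f abs_L2_diff norm_abs_L2 square_integrable_diff)
  have "\<exists>N. \<forall>m\<ge>N. \<forall>n\<ge>N. norm (X m - X n) < (1/2) ^ k" for k
    using CauchyD[OF X, of "(1/2) ^ k"] by simp
  then obtain N where N: "\<And>k m n. m \<ge> N k \<Longrightarrow> n \<ge> N k \<Longrightarrow> norm (X m - X n) < (1/2) ^ k"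
    by metis
  \<comment> \<open>Summing the thresholds makes them monotone, which is what Fatou's lemma needs below.\<close>
  define r where "r k = (\<Sum>i\<le>k. N i)" for k
  have r_mono: "r j \<le> r k" if "j \<le> k" for j k
    unfolding r_def using that by (intro sum_mono2) auto
  have r_N: "N k \<le> r k" for k
    unfolding r_def by (intro member_le_sum) auto
  define d where "d k x = f (r (Suc k)) x - f (r k) x" for k x
  have [measurable]: "d k \<in> borel_measurable unit_ivl_measure" for k
    unfolding d_def by measurable
  have d_int: "(LINT x|unit_ivl_measure. (d k x)\<^sup>2) \<le> (1/4) ^ k" for k
  proof -
    have "norm (X (r (Suc k)) - X (r k)) < (1/2) ^ k"
      using N[of k "r (Suc k)" "r k"] r_N[of k] r_mono[of k "Suc k"] by simp
    then have "(norm (X (r (Suc k)) - X (r k)))\<^sup>2 \<le> ((1/2) ^ k)\<^sup>2"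
      by (intro power_mono) auto
    also have "((1/2::real) ^ k)\<^sup>2 = (1/4) ^ k"
      by (simp add: power2_eq_square flip: power_mult_distrib)
    finally show ?thesis
      by (simp add: norm_X d_def)
  qed
  \<comment> \<open>The squares decrease like \<open>4\<^sup>-\<^sup>k\<close>; with the weight \<open>2 ^ k\<close> they are still summable, and the
      weight lets them control the differences themselves, since
      \<open>\<bar>d\<bar> \<le> 2\<^sup>-\<^sup>k + 2\<^sup>k d\<^sup>2\<close> by the arithmetic-geometric mean inequality.\<close>
  have "(\<integral>\<^sup>+x. (\<Sum>k. ennreal (2 ^ k * (d k x)\<^sup>2)) \<partial>unit_ivl_measure)
      = (\<Sum>k. \<integral>\<^sup>+x. ennreal (2 ^ k * (d k x)\<^sup>2) \<partial>unit_ivl_measure)"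
    by (rule nn_integral_suminf) measurable
  also have "\<dots> \<le> (\<Sum>k. ennreal ((1/2) ^ k))"
  proof (rule suminf_le)
    fix k
    have "(\<integral>\<^sup>+x. ennreal (2 ^ k * (d k x)\<^sup>2) \<partial>unit_ivl_measure)
        = ennreal (LINT x|unit_ivl_measure. 2 ^ k * (d k x)\<^sup>2)"
      using intd by (intro nn_integral_eq_integral) (auto simp: d_def)
    also have "(LINT x|unit_ivl_measure. 2 ^ k * (d k x)\<^sup>2) \<le> 2 ^ k * (1/4) ^ k"
      using d_int[of k] by simp
    also have "(2::real) ^ k * (1/4) ^ k = (1/2) ^ k"
      by (simp flip: power_mult_distrib)
    finally show "(\<integral>\<^sup>+x. ennreal (2 ^ k * (d k x)\<^sup>2) \<partial>unit_ivl_measure) \<le> ennreal ((1/2) ^ k)"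
      by (simp add: ennreal_leI)
  qed auto
  also have "\<dots> = ennreal (\<Sum>k. (1/2) ^ k)"
    by (rule suminf_ennreal2) (auto intro: summable_geometric)
  also have "\<dots> < \<infinity>" by simp
  finally have "AE x in unit_ivl_measure. (\<Sum>k. ennreal (2 ^ k * (d k x)\<^sup>2)) \<noteq> \<infinity>"
    by (intro nn_integral_PInf_AE) auto
  then have conv: "AE x in unit_ivl_measure. convergent (\<lambda>k. f (r k) x)"
  proof eventually_elim
    case (elim x)
    then have "summable (\<lambda>k. 2 ^ k * (d k x)\<^sup>2)"
      by (intro summable_suminf_not_top) auto
    then have sm: "summable (\<lambda>k. (1/2) ^ k + 2 ^ k * (d k x)\<^sup>2)"
      by (intro summable_add summable_geometric) auto
    have "\<bar>d k x\<bar> \<le> (1/2) ^ k + 2 ^ k * (d k x)\<^sup>2" for k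
    proof -
      have "0 \<le> ((1/2) ^ k - \<bar>d k x\<bar>)\<^sup>2 * 2 ^ k" by simp
      also have "\<dots> = (1/2) ^ k - 2 * \<bar>d k x\<bar> + 2 ^ k * (d k x)\<^sup>2"
        by (simp add: power2_eq_square algebra_simps power_divide)
      finally show ?thesis by linarith
    qed
    then have "summable (\<lambda>k. d k x)"
      by (intro summable_comparison_test'[OF sm]) auto
    then have "convergent (\<lambda>n. \<Sum>k<n. d k x)"
      by (simp add: summable_iff_convergent)
    then have "convergent (\<lambda>n. f (r n) x - f (r 0) x)"
      by (simp add: d_def sum_lessThan_telescope[of "\<lambda>k. f (r k) x"])
    then show ?case
      using convergent_add[OF _ convergent_const[of "f (r 0) x"]] by fastforce
  qed
  define F where "F x = lim (\<lambda>k. f (r k) x)" for x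
  have [measurable]: "F \<in> borel_measurable unit_ivl_measure"
    unfolding F_def by measurable
  have limF: "AE x in unit_ivl_measure. (\<lambda>k. f (r k) x) \<longlonglongrightarrow> F x"
    using conv by eventually_elim (simp add: F_def convergent_LIMSEQ_iff)
  have close: "(\<integral>\<^sup>+x. ennreal ((f n x - F x)\<^sup>2) \<partial>unit_ivl_measure) \<le> ennreal (((1/2) ^ k)\<^sup>2)" if n: "n \<ge> N k" for n k
  proof -
    have "(\<integral>\<^sup>+x. ennreal ((f n x - F x)\<^sup>2) \<partial>unit_ivl_measure)
        = (\<integral>\<^sup>+x. liminf (\<lambda>j. ennreal ((f n x - f (r j) x)\<^sup>2)) \<partial>unit_ivl_measure)"
    proof (rule nn_integral_cong_AE)
      show "AE x in unit_ivl_measure. ennreal ((f n x - F x)\<^sup>2) = liminf (\<lambda>j. ennreal ((f n x - f (r j) x)\<^sup>2))"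
        using limF
      proof eventually_elim
        case (elim x)
        have "(\<lambda>j. ennreal ((f n x - f (r j) x)\<^sup>2)) \<longlonglongrightarrow> ennreal ((f n x - F x)\<^sup>2)"
          by (intro tendsto_ennrealI tendsto_intros elim)
        then show ?case
          by (rule lim_imp_Liminf[OF trivial_limit_sequentially, symmetric])
      qed
    qed
    also have "\<dots> \<le> liminf (\<lambda>j. \<integral>\<^sup>+x. ennreal ((f n x - f (r j) x)\<^sup>2) \<partial>unit_ivl_measure)"
      by (rule nn_integral_liminf) measurable
    also have "\<dots> \<le> limsup (\<lambda>j. \<integral>\<^sup>+x. ennreal ((f n x - f (r j) x)\<^sup>2) \<partial>unit_ivl_measure)"
      by (rule Liminf_le_Limsup) simp
    also have "\<dots> \<le> ennreal (((1/2) ^ k)\<^sup>2)"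
    proof (rule Limsup_bounded)
      show "\<forall>\<^sub>F j in sequentially. (\<integral>\<^sup>+x. ennreal ((f n x - f (r j) x)\<^sup>2) \<partial>unit_ivl_measure) \<le> ennreal (((1/2) ^ k)\<^sup>2)"
        using eventually_ge_at_top[of k]
      proof eventually_elim
        case (elim j)
        have "norm (X n - X (r j)) < (1/2) ^ k"
          using N[OF n] r_N[of k] r_mono[OF elim] by simp
        then have "(norm (X n - X (r j)))\<^sup>2 \<le> ((1/2) ^ k)\<^sup>2"
          by (intro power_mono) auto
        moreover have "(\<integral>\<^sup>+x. ennreal ((f n x - f (r j) x)\<^sup>2) \<partial>unit_ivl_measure)
            = ennreal ((norm (X n - X (r j)))\<^sup>2)"
          unfolding norm_X using intd by (intro nn_integral_eq_integral) auto
        ultimately show ?case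
          by (simp only: ennreal_leI)
      qed
    qed
    finally show ?thesis .
  qed
  have sq_diff: "square_integrable (\<lambda>x. f n x - F x)" if "n \<ge> N k" for n k
    unfolding square_integrable_def
  proof
    show "integrable unit_ivl_measure (\<lambda>x. (f n x - F x)\<^sup>2)"
      using close[OF that] by (intro integrableI_nonneg) (auto simp: order_le_less_trans)
  qed measurable
  have "square_integrable (\<lambda>x. f (N 0) x - (f (N 0) x - F x))"
    using square_integrable_diff[OF f sq_diff[OF order_refl]] .
  then have F: "square_integrable F" by simp
  have "X \<longlonglongrightarrow> abs_L2 F"
  proof (rule LIMSEQ_I)
    fix e :: real assume "e > 0"
    then obtain k where k: "(1/2) ^ k < e"
      using real_arch_pow_inv[of e "1/2"] by auto
    have "norm (X n - abs_L2 F) < e" if n: "n \<ge> N k" for n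
    proof -
      have "(norm (X n - abs_L2 F))\<^sup>2 = (LINT x|unit_ivl_measure. (f n x - F x)\<^sup>2)"
        using f F sq_diff[OF n] by (simp add: X_f abs_L2_diff norm_abs_L2)
      also have "\<dots> \<le> ((1/2) ^ k)\<^sup>2"
      proof -
        have "ennreal (LINT x|unit_ivl_measure. (f n x - F x)\<^sup>2) = (\<integral>\<^sup>+x. ennreal ((f n x - F x)\<^sup>2) \<partial>unit_ivl_measure)"
          using sq_diff[OF n] by (intro nn_integral_eq_integral[symmetric]) (auto simp: square_integrable_def)
        then show ?thesis
          using close[OF n] by (simp only: ennreal_le_iff[OF zero_le_power2] flip: \<open>ennreal _ = _\<close>)
      qed
      finally have "norm (X n - abs_L2 F) \<le> (1/2) ^ k"
        by (rule power2_le_imp_le) simp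
      with k show ?thesis by simp
    qed
    then show "\<exists>no. \<forall>n\<ge>no. norm (X n - abs_L2 F) < e" by blast
  qed
  then show "convergent X"
    by (auto simp: convergent_def)
qed

text \<open>Dominated convergence applied to the squares of the differences, which are bounded by
\<open>4 * (h x)\<^sup>2\<close>.\<close>

lemma tendsto_abs_L2_dominated:
  assumes f: "f \<in> borel_measurable unit_ivl_measure"
    and s: "\<And>n. s n \<in> borel_measurable unit_ivl_measure"
    and h: "square_integrable h"
    and lim: "AE x in unit_ivl_measure. (\<lambda>n. s n x) \<longlonglongrightarrow> f x"
    and bound: "\<And>n. AE x in unit_ivl_measure. \<bar>s n x\<bar> \<le> h x"
  shows "square_integrable f" and "\<And>n. square_integrable (s n)"
    and "(\<lambda>n. abs_L2 (s n)) \<longlonglongrightarrow> abs_L2 f"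
proof -
  have f_le: "AE x in unit_ivl_measure. \<bar>f x\<bar> \<le> h x"
  proof -
    have "AE x in unit_ivl_measure. \<forall>n. \<bar>s n x\<bar> \<le> h x"
      using bound by (simp add: AE_all_countable)
    with lim show ?thesis
    proof eventually_elim
      case (elim x)
      then show ?case
        by (intro LIMSEQ_le_const2[OF tendsto_rabs]) auto
    qed
  qed
  show f_sq: "square_integrable f"
    using f h f_le by (rule square_integrable_dominated)
  show s_sq: "square_integrable (s n)" for n
    using s h bound by (rule square_integrable_dominated)
  have "(\<lambda>n. LINT x|unit_ivl_measure. (s n x - f x)\<^sup>2) \<longlonglongrightarrow> (LINT x|unit_ivl_measure. 0)"
  proof (rule integral_dominated_convergence[where w = "\<lambda>x. 4 * (h x)\<^sup>2"])
    show "integrable unit_ivl_measure (\<lambda>x. 4 * (h x)\<^sup>2)"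
      using h by (simp add: square_integrable_def)
    show "AE x in unit_ivl_measure. (\<lambda>n. (s n x - f x)\<^sup>2) \<longlonglongrightarrow> 0"
      using lim
    proof eventually_elim
      case (elim x)
      then show ?case
        using tendsto_power[OF tendsto_diff[OF elim tendsto_const[of "f x"]], of 2] by simp
    qed
    show "AE x in unit_ivl_measure. norm ((s n x - f x)\<^sup>2) \<le> 4 * (h x)\<^sup>2" for n
      using bound[of n] f_le
    proof eventually_elim
      case (elim x)
      then have "\<bar>s n x - f x\<bar> \<le> \<bar>2 * h x\<bar>" by linarith
      then have "(s n x - f x)\<^sup>2 \<le> (2 * h x)\<^sup>2" by (simp add: abs_le_square_iff)
      then show ?case by (simp add: power_mult_distrib)
    qed
  qed (use f s in measurable)
  then have "(\<lambda>n. (norm (abs_L2 (s n) - abs_L2 f))\<^sup>2) \<longlonglongrightarrow> 0"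
    using f_sq s_sq by (simp add: abs_L2_diff norm_abs_L2 square_integrable_diff)
  then have "(\<lambda>n. sqrt ((norm (abs_L2 (s n) - abs_L2 f))\<^sup>2)) \<longlonglongrightarrow> sqrt 0"
    by (rule tendsto_real_sqrt)
  then show "(\<lambda>n. abs_L2 (s n)) \<longlonglongrightarrow> abs_L2 f"
    by (simp add: tendsto_norm_zero_iff flip: LIM_zero_iff[of _ "abs_L2 f"])
qed

lemma square_integrable_clip:
  assumes "f \<in> borel_measurable unit_ivl_measure"
  shows "square_integrable (\<lambda>x. max (- B) (min B (f x)))"
proof (rule square_integrable_bounded[where B = "\<bar>B\<bar>"])
  show "(\<lambda>x. max (- B) (min B (f x))) \<in> borel_measurable unit_ivl_measure"
    using assms by measurable
qed auto

text \<open>Continuous functions are uniform limits of polynomials; a bounded measurable function is an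
almost everywhere limit of continuous functions, which may be truncated at the same height; and
every function is the limit of its truncations.\<close>

lemma polynomials_dense_L2:
  assumes "square_integrable f"
  shows "abs_L2 f \<in> closure {abs_L2 p |p. real_polynomial_function p}" (is "_ \<in> ?D")
proof -
  have closedD: "u \<in> ?D" if "\<And>n::nat. s n \<in> ?D" "s \<longlonglongrightarrow> u" for s u
    using closed_sequentially[OF closed_closure] that by blast
  have cont: "abs_L2 g \<in> ?D" if g: "continuous_on {0..1} g" for g
  proof -
    have "\<exists>p. real_polynomial_function p \<and> (\<forall>x\<in>{0..1}. \<bar>g x - p x\<bar> < inverse (real (Suc n)))" for n
      by (rule Stone_Weierstrass_real_polynomial_function[OF compact_Icc g, of "inverse (real (Suc n))"]) auto
    then obtain p where p: "\<And>n. real_polynomial_function (p n)"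
      "\<And>n x. x \<in> {0..1} \<Longrightarrow> \<bar>g x - p n x\<bar> < inverse (real (Suc n))"
      by metis
    have contp: "continuous_on {0..1} (p n)" for n
      using p(1) by (metis continuous_on_polymonial_function real_polynomial_function_eq)
    have lim: "(\<lambda>n. p n x) \<longlonglongrightarrow> g x" if "x \<in> {0..1}" for x
    proof -
      have "(\<lambda>n. p n x - g x) \<longlonglongrightarrow> 0"
        using p(2)[OF that]
        by (intro Lim_null_comparison[OF _ LIMSEQ_inverse_real_of_nat])
           (auto intro!: always_eventually less_imp_le simp: abs_minus_commute)
      then show ?thesis by (simp add: LIM_zero_iff)
    qed
    have bd: "\<bar>p n x\<bar> \<le> \<bar>g x\<bar> + 1" if "x \<in> {0..1}" for n x
      using p(2)[OF that, of n] le_imp_inverse_le[of 1 "real (Suc n)"] by simp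
    have sq: "square_integrable (\<lambda>x. \<bar>g x\<bar> + 1)"
      using g by (intro square_integrable_continuous continuous_intros)
    have "(\<lambda>n. abs_L2 (p n)) \<longlonglongrightarrow> abs_L2 g"
    proof (rule tendsto_abs_L2_dominated(3)[OF _ _ sq])
      show "g \<in> borel_measurable unit_ivl_measure" "p n \<in> borel_measurable unit_ivl_measure" for n
        using square_integrable_continuous g contp by (simp_all add: square_integrable_def)
      show "AE x in unit_ivl_measure. (\<lambda>n. p n x) \<longlonglongrightarrow> g x"
        by (rule AE_unit_ivl_I, rule lim) simp
      show "AE x in unit_ivl_measure. \<bar>p n x\<bar> \<le> \<bar>g x\<bar> + 1" for n
        by (rule AE_unit_ivl_I, rule bd) simp
    qed
    note lim_p = this
    have "abs_L2 (p n) \<in> ?D" for n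
      using p(1) by (intro closure_subset[THEN subsetD]) auto
    then show ?thesis using lim_p by (rule closedD)
  qed
  have clip: "abs_L2 (\<lambda>x. max (- B) (min B (f x))) \<in> ?D" if "f \<in> borel_measurable unit_ivl_measure" "B \<ge> 0" for f B
  proof -
    have "f measurable_on {0<..<1}"
      using that by (simp add: measurable_on_iff_borel_measurable)
    then obtain N g where N: "negligible N" and g: "\<And>n::nat. continuous_on UNIV (g n)"
      and lim: "\<And>x. x \<notin> N \<Longrightarrow> (\<lambda>n. g n x) \<longlonglongrightarrow> (if x \<in> {0<..<1} then f x else 0)"
      unfolding measurable_on_def by blast
    have cl: "continuous_on {0..1} (\<lambda>x. max (- B) (min B (g n x)))" for n
      by (intro continuous_intros continuous_on_subset[OF g]) auto
    have "(\<lambda>n. abs_L2 (\<lambda>x. max (- B) (min B (g n x)))) \<longlonglongrightarrow> abs_L2 (\<lambda>x. max (- B) (min B (f x)))"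
    proof (rule tendsto_abs_L2_dominated(3)[where h = "\<lambda>x. B"])
      have "AE x in unit_ivl_measure. x \<notin> N"
        unfolding AE_unit_ivl_iff using N by (auto simp: negligible_iff_null_sets dest: AE_not_in)
      then show "AE x in unit_ivl_measure. (\<lambda>n. max (- B) (min B (g n x))) \<longlonglongrightarrow> max (- B) (min B (f x))"
        using AE_space
      proof eventually_elim
        case (elim x)
        then show ?case
          using lim[of x] by (intro tendsto_intros) auto
      qed
    qed (use square_integrable_continuous[OF cl] square_integrable_clip[OF that(1)] that(2) in
        \<open>auto simp: square_integrable_def\<close>)
    then show ?thesis
      by (rule closedD[OF cont[OF cl]])
  qed
  have fm: "f \<in> borel_measurable unit_ivl_measure"
    using assms by (simp add: square_integrable_def)
  have "(\<lambda>n. abs_L2 (\<lambda>x. max (- real n) (min (real n) (f x)))) \<longlonglongrightarrow> abs_L2 f"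
  proof (rule tendsto_abs_L2_dominated(3)[where h = "\<lambda>x. \<bar>f x\<bar>"])
    show "square_integrable (\<lambda>x. \<bar>f x\<bar>)"
      using assms by (auto simp: square_integrable_def)
    show "AE x in unit_ivl_measure. (\<lambda>n. max (- real n) (min (real n) (f x))) \<longlonglongrightarrow> f x"
    proof (rule AE_I2)
      fix x
      have "\<forall>\<^sub>F n in sequentially. max (- real n) (min (real n) (f x)) = f x"
        using eventually_ge_at_top[of "nat \<lceil>\<bar>f x\<bar>\<rceil>"] by eventually_elim (auto simp: max_def min_def)
      then show "(\<lambda>n. max (- real n) (min (real n) (f x))) \<longlonglongrightarrow> f x"
        by (rule tendsto_eventually)
    qed
  qed (use fm square_integrable_clip[OF fm] in \<open>auto simp: square_integrable_def\<close>)
  then show ?thesis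
    by (rule closedD[OF clip[OF fm of_nat_0_le_iff]])
qed

section \<open>Integral operators with a dominated symmetric kernel\<close>

text \<open>The value at \<open>x\<close> is written as an inner product with the section of the kernel.  Linearity
is then immediate, and Bessel's inequality applies for each fixed \<open>x\<close>.\<close>

definition integral_op :: "(real \<Rightarrow> real \<Rightarrow> real) \<Rightarrow> L2 \<Rightarrow> L2" where
  "integral_op k u = abs_L2 (\<lambda>x. inner (abs_L2 (k x)) u)"

locale dominated_symmetric_kernel =
  fixes k :: "real \<Rightarrow> real \<Rightarrow> real" and \<rho> :: "real \<Rightarrow> real"
  assumes measurable_kernel [measurable]: "case_prod k \<in> borel_measurable (unit_ivl_measure \<Otimes>\<^sub>M unit_ivl_measure)"
    and square_integrable_bound: "square_integrable \<rho>"
    and bound_nonneg: "0 < x \<Longrightarrow> x < 1 \<Longrightarrow> 0 \<le> \<rho> x"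
    and kernel_le: "0 < x \<Longrightarrow> x < 1 \<Longrightarrow> 0 < y \<Longrightarrow> y < 1 \<Longrightarrow> \<bar>k x y\<bar> \<le> \<rho> x * \<rho> y"
    and kernel_symmetric: "0 < x \<Longrightarrow> x < 1 \<Longrightarrow> 0 < y \<Longrightarrow> y < 1 \<Longrightarrow> k x y = k y x"
begin

lemma square_integrable_kernel_section:
  assumes "0 < x" "x < 1"
  shows "square_integrable (k x)"
proof (rule square_integrable_dominated)
  show "k x \<in> borel_measurable unit_ivl_measure"
    using measurable_compose_Pair1[OF _ measurable_kernel, of x] assms by simp
  show "square_integrable (\<lambda>y. \<rho> x * \<rho> y)"
    using square_integrable_bound by (rule square_integrable_scale)
  show "AE y in unit_ivl_measure. \<bar>k x y\<bar> \<le> \<rho> x * \<rho> y"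
    using assms by (intro AE_unit_ivl_I kernel_le)
qed

lemma norm_kernel_section_le:
  assumes "0 < x" "x < 1"
  shows "norm (abs_L2 (k x)) \<le> \<rho> x * norm (abs_L2 \<rho>)"
proof (rule power2_le_imp_le)
  note sq = square_integrable_kernel_section[OF assms]
  have "(norm (abs_L2 (k x)))\<^sup>2 = (LINT y|unit_ivl_measure. (k x y)\<^sup>2)"
    by (rule norm_abs_L2[OF sq])
  also have "\<dots> \<le> (LINT y|unit_ivl_measure. (\<rho> x)\<^sup>2 * (\<rho> y)\<^sup>2)"
  proof (rule integral_mono_AE)
    show "AE y in unit_ivl_measure. (k x y)\<^sup>2 \<le> (\<rho> x)\<^sup>2 * (\<rho> y)\<^sup>2"
    proof (rule AE_unit_ivl_I)
      fix y :: real assume y: "0 < y" "y < 1"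
      have "(k x y)\<^sup>2 \<le> (\<rho> x * \<rho> y)\<^sup>2"
        using power_mono[OF kernel_le[OF assms y], of 2] by simp
      then show "(k x y)\<^sup>2 \<le> (\<rho> x)\<^sup>2 * (\<rho> y)\<^sup>2"
        by (simp add: power_mult_distrib)
    qed
  qed (use sq square_integrable_bound in \<open>simp_all add: square_integrable_def\<close>)
  also have "\<dots> = (\<rho> x * norm (abs_L2 \<rho>))\<^sup>2"
    by (simp add: power_mult_distrib norm_abs_L2[OF square_integrable_bound])
  finally show "(norm (abs_L2 (k x)))\<^sup>2 \<le> (\<rho> x * norm (abs_L2 \<rho>))\<^sup>2" .
  show "0 \<le> \<rho> x * norm (abs_L2 \<rho>)"
    using bound_nonneg[OF assms] by simp
qed

lemma inner_kernel_section:
  assumes "0 < x" "x < 1" "square_integrable f"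
  shows "inner (abs_L2 (k x)) (abs_L2 f) = (LINT y|unit_ivl_measure. k x y * f y)"
  using square_integrable_kernel_section[OF assms(1,2)] assms(3) by (rule inner_abs_L2)

lemma square_integrable_integral_op:
  "square_integrable (\<lambda>x. inner (abs_L2 (k x)) u)"
proof -
  obtain f where f: "square_integrable f" "u = abs_L2 f"
    by (rule L2_representative)
  have [measurable]: "f \<in> borel_measurable unit_ivl_measure"
    using f(1) by (simp add: square_integrable_def)
  have "(\<lambda>x. LINT y|unit_ivl_measure. k x y * f y) \<in> borel_measurable unit_ivl_measure"
    by measurable
  then have meas: "(\<lambda>x. inner (abs_L2 (k x)) u) \<in> borel_measurable unit_ivl_measure"
    using inner_kernel_section[OF _ _ f(1)] f(2)
    by (subst measurable_cong[where g = "\<lambda>x. LINT y|unit_ivl_measure. k x y * f y"]) auto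
  show ?thesis
  proof (rule square_integrable_dominated[OF meas])
    show "square_integrable (\<lambda>x. (norm (abs_L2 \<rho>) * norm u) * \<rho> x)"
      using square_integrable_bound by (rule square_integrable_scale)
    show "AE x in unit_ivl_measure. \<bar>inner (abs_L2 (k x)) u\<bar> \<le> (norm (abs_L2 \<rho>) * norm u) * \<rho> x"
    proof (rule AE_unit_ivl_I)
      fix x :: real assume x: "0 < x" "x < 1"
      have "\<bar>inner (abs_L2 (k x)) u\<bar> \<le> norm (abs_L2 (k x)) * norm u"
        by (rule Cauchy_Schwarz_ineq2)
      also have "\<dots> \<le> (\<rho> x * norm (abs_L2 \<rho>)) * norm u"
        using norm_kernel_section_le[OF x] by (rule mult_right_mono) simp
      finally show "\<bar>inner (abs_L2 (k x)) u\<bar> \<le> (norm (abs_L2 \<rho>) * norm u) * \<rho> x"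
        by (simp add: mult_ac)
    qed
  qed
qed

text \<open>By Bessel's inequality the squares \<open>\<langle>k x, e\<rangle>\<^sup>2\<close> add up to at most the squared norm
of the section \<open>k x\<close>; this is integrated over \<open>x\<close>.\<close>

lemma hilbert_schmidt_integral_op:
  assumes E: "finite_orthonormal E"
  shows "(\<Sum>e\<in>E. (norm (integral_op k e))\<^sup>2) \<le> (norm (abs_L2 \<rho>)) ^ 4"
proof -
  have int: "integrable unit_ivl_measure (\<lambda>x. (inner (abs_L2 (k x)) e)\<^sup>2)" for e
    using square_integrable_integral_op[of e] by (simp add: square_integrable_def)
  have "(\<Sum>e\<in>E. (norm (integral_op k e))\<^sup>2) =
      (\<Sum>e\<in>E. LINT x|unit_ivl_measure. (inner (abs_L2 (k x)) e)\<^sup>2)"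
    unfolding integral_op_def by (simp only: norm_abs_L2[OF square_integrable_integral_op])
  also have "\<dots> = (LINT x|unit_ivl_measure. (\<Sum>e\<in>E. (inner (abs_L2 (k x)) e)\<^sup>2))"
    using int by (intro Bochner_Integration.integral_sum[symmetric])
  also have "\<dots> \<le> (LINT x|unit_ivl_measure. (norm (abs_L2 \<rho>))\<^sup>2 * (\<rho> x)\<^sup>2)"
  proof (rule integral_mono_AE)
    show "AE x in unit_ivl_measure. (\<Sum>e\<in>E. (inner (abs_L2 (k x)) e)\<^sup>2) \<le> (norm (abs_L2 \<rho>))\<^sup>2 * (\<rho> x)\<^sup>2"
    proof (rule AE_unit_ivl_I)
      fix x :: real assume x: "0 < x" "x < 1"
      have "(\<Sum>e\<in>E. (inner (abs_L2 (k x)) e)\<^sup>2) \<le> (norm (abs_L2 (k x)))\<^sup>2"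
        using bessel_inequality[OF E, of "abs_L2 (k x)"] by (simp add: inner_commute)
      also have "\<dots> \<le> (\<rho> x * norm (abs_L2 \<rho>))\<^sup>2"
        using norm_kernel_section_le[OF x] by (rule power_mono) simp
      finally show "(\<Sum>e\<in>E. (inner (abs_L2 (k x)) e)\<^sup>2) \<le> (norm (abs_L2 \<rho>))\<^sup>2 * (\<rho> x)\<^sup>2"
        by (simp add: power_mult_distrib mult.commute)
    qed
    show "integrable unit_ivl_measure (\<lambda>x. \<Sum>e\<in>E. (inner (abs_L2 (k x)) e)\<^sup>2)"
      using int by (rule Bochner_Integration.integrable_sum)
    show "integrable unit_ivl_measure (\<lambda>x. (norm (abs_L2 \<rho>))\<^sup>2 * (\<rho> x)\<^sup>2)"
      using square_integrable_bound by (simp add: square_integrable_def)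
  qed
  also have "\<dots> = (norm (abs_L2 \<rho>))\<^sup>2 * (norm (abs_L2 \<rho>))\<^sup>2"
    by (simp add: norm_abs_L2[OF square_integrable_bound])
  also have "\<dots> = (norm (abs_L2 \<rho>)) ^ 4"
    by (simp flip: power_add)
  finally show ?thesis .
qed

lemma linear_integral_op: "linear (integral_op k)"
proof (rule linearI)
  show "integral_op k (u + v) = integral_op k u + integral_op k v" for u v
    unfolding integral_op_def
    by (simp add: abs_L2_add[OF square_integrable_integral_op square_integrable_integral_op] inner_add_right)
  show "integral_op k (c *\<^sub>R u) = c *\<^sub>R integral_op k u" for c u
    unfolding integral_op_def
    by (simp add: abs_L2_scale[OF square_integrable_integral_op square_integrable_integral_op])
qed

lemma integral_op_abs_L2:
  assumes f: "square_integrable f" and g: "square_integrable g"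
    and eq: "\<And>x. 0 < x \<Longrightarrow> x < 1 \<Longrightarrow> g x = (LINT y|unit_ivl_measure. k x y * f y)"
  shows "integral_op k (abs_L2 f) = abs_L2 g"
  unfolding integral_op_def using square_integrable_integral_op g
proof (rule abs_L2_eqI)
  show "AE x in unit_ivl_measure. inner (abs_L2 (k x)) (abs_L2 f) = g x"
    by (rule AE_unit_ivl_I) (simp add: inner_kernel_section f eq)
qed

lemma inner_integral_op:
  assumes f: "square_integrable f" and g: "square_integrable g"
  shows "inner (integral_op k (abs_L2 f)) (abs_L2 g)
    = (LINT x|unit_ivl_measure. LINT y|unit_ivl_measure. k x y * f y * g x)"
proof -
  have "inner (integral_op k (abs_L2 f)) (abs_L2 g)
      = (LINT x|unit_ivl_measure. inner (abs_L2 (k x)) (abs_L2 f) * g x)"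
    unfolding integral_op_def by (rule inner_abs_L2[OF square_integrable_integral_op g])
  also have "\<dots> = (LINT x|unit_ivl_measure. LINT y|unit_ivl_measure. k x y * f y * g x)"
    by (rule Bochner_Integration.integral_cong) (auto simp: inner_kernel_section f)
  finally show ?thesis .
qed

lemma integrable_kernel_tensor:
  assumes f: "square_integrable f" and g: "square_integrable g"
  shows "integrable (unit_ivl_measure \<Otimes>\<^sub>M unit_ivl_measure) (\<lambda>(x, y). k x y * f y * g x)"
proof (rule unit_square.Fubini_integrable)
  have [measurable]: "f \<in> borel_measurable unit_ivl_measure" "g \<in> borel_measurable unit_ivl_measure"
    using f g by (simp_all add: square_integrable_def)
  have abs_sq: "square_integrable (\<lambda>x. \<bar>h x\<bar>)" if "square_integrable h" for h
    using that by (auto simp: square_integrable_def)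
  show "(\<lambda>(x, y). k x y * f y * g x) \<in> borel_measurable (unit_ivl_measure \<Otimes>\<^sub>M unit_ivl_measure)"
    by measurable
  have sec: "integrable unit_ivl_measure (\<lambda>y. k x y * f y * g x)" if "0 < x" "x < 1" for x
    using square_integrable_mult[OF square_integrable_kernel_section[OF that] f] by simp
  show "AE x in unit_ivl_measure. integrable unit_ivl_measure (\<lambda>y. case (x, y) of (x, y) \<Rightarrow> k x y * f y * g x)"
    using sec by (intro AE_unit_ivl_I) simp
  define c where "c = (LINT y|unit_ivl_measure. \<rho> y * \<bar>f y\<bar>)"
  have int\<rho>f: "integrable unit_ivl_measure (\<lambda>y. \<rho> y * \<bar>f y\<bar>)"
    using square_integrable_mult[OF square_integrable_bound abs_sq[OF f]] .
  have "integrable unit_ivl_measure (\<lambda>x. LINT y|unit_ivl_measure. \<bar>k x y * f y * g x\<bar>)"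
  proof (rule Bochner_Integration.integrable_bound)
    show "integrable unit_ivl_measure (\<lambda>x. c * (\<rho> x * \<bar>g x\<bar>))"
      using square_integrable_mult[OF square_integrable_bound abs_sq[OF g]] by simp
    show "(\<lambda>x. LINT y|unit_ivl_measure. \<bar>k x y * f y * g x\<bar>) \<in> borel_measurable unit_ivl_measure"
      by measurable
    show "AE x in unit_ivl_measure. norm (LINT y|unit_ivl_measure. \<bar>k x y * f y * g x\<bar>) \<le> norm (c * (\<rho> x * \<bar>g x\<bar>))"
    proof (rule AE_unit_ivl_I)
      fix x :: real assume x: "0 < x" "x < 1"
      have "(LINT y|unit_ivl_measure. \<bar>k x y * f y * g x\<bar>)
          \<le> (LINT y|unit_ivl_measure. (\<rho> x * \<bar>g x\<bar>) * (\<rho> y * \<bar>f y\<bar>))"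
      proof (rule integral_mono_AE)
        show "AE y in unit_ivl_measure. \<bar>k x y * f y * g x\<bar> \<le> (\<rho> x * \<bar>g x\<bar>) * (\<rho> y * \<bar>f y\<bar>)"
        proof (rule AE_unit_ivl_I)
          fix y :: real assume y: "0 < y" "y < 1"
          have "\<bar>k x y\<bar> * (\<bar>f y\<bar> * \<bar>g x\<bar>) \<le> (\<rho> x * \<rho> y) * (\<bar>f y\<bar> * \<bar>g x\<bar>)"
            using kernel_le[OF x y] by (rule mult_right_mono) simp
          then show "\<bar>k x y * f y * g x\<bar> \<le> (\<rho> x * \<bar>g x\<bar>) * (\<rho> y * \<bar>f y\<bar>)"
            by (simp add: abs_mult mult_ac)
        qed
      qed (use sec[OF x] int\<rho>f in simp_all)
      also have "\<dots> = c * (\<rho> x * \<bar>g x\<bar>)"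
        by (simp add: c_def)
      finally show "norm (LINT y|unit_ivl_measure. \<bar>k x y * f y * g x\<bar>) \<le> norm (c * (\<rho> x * \<bar>g x\<bar>))"
        by (simp add: abs_of_nonneg integral_nonneg_AE)
    qed
  qed
  then show "integrable unit_ivl_measure (\<lambda>x. LINT y|unit_ivl_measure. norm (case (x, y) of (x, y) \<Rightarrow> k x y * f y * g x))"
    by simp
qed

lemma symmetric_integral_op:
  "inner (integral_op k u) v = inner u (integral_op k v)"
proof -
  obtain f where f: "square_integrable f" "u = abs_L2 f"
    by (rule L2_representative)
  obtain g where g: "square_integrable g" "v = abs_L2 g"
    by (rule L2_representative)
  have "inner (integral_op k u) v
      = (LINT x|unit_ivl_measure. LINT y|unit_ivl_measure. k x y * f y * g x)"
    using f g by (simp add: inner_integral_op)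
  also have "\<dots> = (LINT y|unit_ivl_measure. LINT x|unit_ivl_measure. k x y * f y * g x)"
    by (rule unit_square.Fubini_integral[OF integrable_kernel_tensor[OF f(1) g(1)], symmetric])
  also have "\<dots> = (LINT y|unit_ivl_measure. LINT x|unit_ivl_measure. k y x * g x * f y)"
    by (intro Bochner_Integration.integral_cong) (auto simp: kernel_symmetric mult_ac)
  also have "\<dots> = inner (integral_op k v) u"
    using f g by (simp add: inner_integral_op)
  finally show ?thesis
    by (simp add: inner_commute)
qed

sublocale integral_op: symmetric_hilbert_schmidt "integral_op k" "(norm (abs_L2 \<rho>)) ^ 4"
  by (rule symmetric_hilbert_schmidt.intro[OF linear_integral_op symmetric_integral_op
      hilbert_schmidt_integral_op])

end

section \<open>The Green function of the degenerate operator\<close>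

text \<open>The solutions of \<open>(x\<^sup>\<beta> u')' = 0\<close> are spanned by \<open>1\<close> and
\<open>x powr (1 - \<beta>)\<close>.  The left solution vanishes at \<open>0\<close> if \<open>\<beta> < 1\<close> and is the bounded one
if \<open>\<beta> > 1\<close>; the right solution vanishes at \<open>1\<close> and is normalised to have flux \<open>-1\<close>.  The
constant value of \<open>x\<^sup>\<beta> u'\<close> for the left solution is \<open>left_flux\<close>.\<close>

definition left_solution :: "real \<Rightarrow> real \<Rightarrow> real" where
  "left_solution \<beta> x = (if \<beta> < 1 then x powr (1 - \<beta>) else 1)"

definition right_solution :: "real \<Rightarrow> real \<Rightarrow> real" where
  "right_solution \<beta> x = (1 - x powr (1 - \<beta>)) / (1 - \<beta>)"

definition left_flux :: "real \<Rightarrow> real" where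
  "left_flux \<beta> = (if \<beta> < 1 then 1 - \<beta> else 0)"

definition green :: "real \<Rightarrow> real \<Rightarrow> real \<Rightarrow> real" where
  "green \<beta> x y = left_solution \<beta> (min x y) * right_solution \<beta> (max x y)"

definition green_bound :: "real \<Rightarrow> real \<Rightarrow> real" where
  "green_bound \<beta> x = x powr (- \<bar>1 - \<beta>\<bar> / 2) / sqrt \<bar>1 - \<beta>\<bar>"

lemma abs_continuous_on_ivl_lipschitz:
  assumes L: "\<And>x y. a \<le> x \<Longrightarrow> x \<le> b \<Longrightarrow> a \<le> y \<Longrightarrow> y \<le> b \<Longrightarrow> \<bar>f y - f x\<bar> \<le> L * \<bar>y - x\<bar>"
    and "L > 0"
  shows "abs_continuous_on_ivl a b f"
  unfolding abs_continuous_on_ivl_def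
proof (intro allI impI)
  fix e :: real assume "e > 0"
  show "\<exists>d>0. \<forall>I. finite I \<and> (\<forall>(s, t)\<in>I. a \<le> s \<and> s < t \<and> t \<le> b) \<and>
        pairwise (\<lambda>(s, t) (s', t'). disjnt {s<..<t} {s'<..<t'}) I \<and>
        (\<Sum>(s, t)\<in>I. t - s) < d \<longrightarrow> (\<Sum>(s, t)\<in>I. \<bar>f t - f s\<bar>) < e"
  proof (intro exI[of _ "e / L"] conjI allI impI)
    show "0 < e / L" using \<open>e > 0\<close> \<open>L > 0\<close> by simp
    fix I :: "(real \<times> real) set"
    assume I: "finite I \<and> (\<forall>(s, t)\<in>I. a \<le> s \<and> s < t \<and> t \<le> b) \<and>
        pairwise (\<lambda>(s, t) (s', t'). disjnt {s<..<t} {s'<..<t'}) I \<and> (\<Sum>(s, t)\<in>I. t - s) < e / L"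
    have "(\<Sum>(s, t)\<in>I. \<bar>f t - f s\<bar>) \<le> (\<Sum>(s, t)\<in>I. L * (t - s))"
    proof (rule sum_mono)
      fix p assume "p \<in> I"
      moreover obtain s t where p: "p = (s, t)" by force
      ultimately have "a \<le> s" "s < t" "t \<le> b" using I by auto
      then show "(case p of (s, t) \<Rightarrow> \<bar>f t - f s\<bar>) \<le> (case p of (s, t) \<Rightarrow> L * (t - s))"
        using L[of s t] by (simp add: p)
    qed
    also have "\<dots> = L * (\<Sum>(s, t)\<in>I. t - s)"
      by (simp add: sum_distrib_left case_prod_unfold)
    also have "\<dots> < L * (e / L)"
      using I \<open>L > 0\<close> by (intro mult_strict_left_mono) auto
    also have "\<dots> = e" using \<open>L > 0\<close> by simp
    finally show "(\<Sum>(s, t)\<in>I. \<bar>f t - f s\<bar>) < e" .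
  qed
qed

lemma polynomial_lipschitz_unit_ivl:
  assumes "0 \<le> x" "x \<le> 1" "0 \<le> y" "y \<le> (1::real)"
  shows "\<bar>(\<Sum>i\<le>n. a i * y ^ i) - (\<Sum>i\<le>n. a i * x ^ i)\<bar> \<le> (\<Sum>i\<le>n. \<bar>a i\<bar> * real i) * \<bar>y - x\<bar>"
proof -
  have "\<bar>(\<Sum>i\<le>n. a i * y ^ i) - (\<Sum>i\<le>n. a i * x ^ i)\<bar> = \<bar>\<Sum>i\<le>n. a i * (y ^ i - x ^ i)\<bar>"
    by (simp add: sum_subtractf right_diff_distrib)
  also have "\<dots> \<le> (\<Sum>i\<le>n. \<bar>a i\<bar> * \<bar>y ^ i - x ^ i\<bar>)"
    by (rule order_trans[OF sum_abs]) (simp add: abs_mult)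
  also have "\<dots> \<le> (\<Sum>i\<le>n. \<bar>a i\<bar> * (real i * \<bar>y - x\<bar>))"
    using assms norm_power_diff[of y x] by (intro sum_mono mult_left_mono) auto
  finally show ?thesis
    by (simp add: sum_distrib_right mult.assoc)
qed

locale degenerate_exponent =
  fixes \<beta> :: real
  assumes pos: "0 < \<beta>" and less_2: "\<beta> < 2" and neq_1: "\<beta> \<noteq> 1"
begin

text \<open>This is the statement that the Wronskian is one, so that the kernel \<open>green\<close> has
the right normalisation; in this form it treats the ranges \<open>\<beta> < 1\<close> and \<open>\<beta> > 1\<close> together.\<close>

lemma left_right_identity: "0 < x \<Longrightarrow> left_solution \<beta> x + left_flux \<beta> * right_solution \<beta> x = 1"
  using neq_1 by (simp add: left_solution_def right_solution_def left_flux_def field_simps)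

lemma left_solution_deriv:
  assumes "0 < x"
  shows "(left_solution \<beta> has_real_derivative left_flux \<beta> * x powr (- \<beta>)) (at x)"
proof (cases "\<beta> < 1")
  case True
  then have "left_solution \<beta> = (\<lambda>x. x powr (1 - \<beta>))" "left_flux \<beta> = 1 - \<beta>"
    by (simp_all add: left_solution_def left_flux_def fun_eq_iff)
  then show ?thesis
    using has_real_derivative_powr[OF assms, of "1 - \<beta>"] by simp
next
  case False
  then have "left_solution \<beta> = (\<lambda>x. 1)" "left_flux \<beta> = 0"
    by (simp_all add: left_solution_def left_flux_def fun_eq_iff)
  then show ?thesis by simp
qed

lemma right_solution_deriv:
  assumes "0 < x"
  shows "(right_solution \<beta> has_real_derivative - (x powr (- \<beta>))) (at x)"
proof -
  have "((\<lambda>x. (1 - x powr (1 - \<beta>)) / (1 - \<beta>)) has_real_derivative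
      (0 - (1 - \<beta>) * x powr (1 - \<beta> - 1)) / (1 - \<beta>)) (at x)"
    by (intro DERIV_cdivide DERIV_diff DERIV_const has_real_derivative_powr assms)
  then show ?thesis
    using neq_1 by (simp add: right_solution_def[abs_def])
qed

lemma left_solution_continuous: "continuous_on {0..1} (left_solution \<beta>)"
proof (cases "\<beta> < 1")
  case True
  then have "left_solution \<beta> = (\<lambda>x. x powr (1 - \<beta>))"
    by (simp add: left_solution_def fun_eq_iff)
  moreover have "continuous_on {0..1} (\<lambda>x::real. x powr (1 - \<beta>))"
    using True by (intro continuous_on_powr' continuous_intros) auto
  ultimately show ?thesis by simp
next
  case False
  then have "left_solution \<beta> = (\<lambda>x. 1)"
    by (simp add: left_solution_def fun_eq_iff)
  then show ?thesis by simp
qed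

lemma left_solution_bounds:
  assumes "0 < x" "x < 1"
  shows "0 \<le> left_solution \<beta> x" "left_solution \<beta> x \<le> 1"
  using assms by (auto simp: left_solution_def powr_le1)

lemma right_solution_bounds:
  assumes "0 < x" "x < 1"
  shows "0 \<le> right_solution \<beta> x" "right_solution \<beta> x \<le> x powr (- \<bar>1 - \<beta>\<bar>) / \<bar>1 - \<beta>\<bar>"
proof -
  have "0 \<le> right_solution \<beta> x \<and> right_solution \<beta> x \<le> x powr (- \<bar>1 - \<beta>\<bar>) / \<bar>1 - \<beta>\<bar>"
  proof (cases "\<beta> < 1")
    case True
    have "x powr (1 - \<beta>) \<le> 1"
      using assms True by (intro powr_le1) auto
    moreover have "1 \<le> x powr (- (1 - \<beta>))"
      using assms True powr_mono'[of "- (1 - \<beta>)" 0 x] by simp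
    moreover have "0 \<le> x powr (1 - \<beta>)" by simp
    ultimately have "1 - x powr (1 - \<beta>) \<le> x powr (- (1 - \<beta>))" by linarith
    then show ?thesis
      using True \<open>x powr (1 - \<beta>) \<le> 1\<close> by (simp add: right_solution_def divide_right_mono)
  next
    case False
    then have b: "\<beta> > 1" using neq_1 by simp
    have "1 \<le> x powr (1 - \<beta>)"
      using assms b powr_mono'[of "1 - \<beta>" 0 x] by simp
    moreover have "right_solution \<beta> x = (x powr (1 - \<beta>) - 1) / (\<beta> - 1)"
      using b by (simp add: right_solution_def field_simps)
    ultimately show ?thesis
      using b by (simp add: divide_right_mono)
  qed
  then show "0 \<le> right_solution \<beta> x" "right_solution \<beta> x \<le> x powr (- \<bar>1 - \<beta>\<bar>) / \<bar>1 - \<beta>\<bar>"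
    by simp_all
qed

text \<open>For \<open>m = max x y\<close> the kernel is at most \<open>m powr (- s) / s\<close> with
\<open>s = \<bar>1 - \<beta>\<bar>\<close>.  Splitting the power into two equal factors and using \<open>x \<le> m\<close> and \<open>y \<le> m\<close>
turns this into a product of functions of one variable.\<close>

lemma green_le:
  assumes "0 < x" "x < 1" "0 < y" "y < 1"
  shows "\<bar>green \<beta> x y\<bar> \<le> green_bound \<beta> x * green_bound \<beta> y"
proof -
  define m where "m = max x y"
  define s where "s = \<bar>1 - \<beta>\<bar>"
  have m: "0 < m" "m < 1" "x \<le> m" "y \<le> m"
    using assms by (auto simp: m_def)
  have s: "s > 0" using neq_1 by (simp add: s_def)
  have "\<bar>green \<beta> x y\<bar> \<le> 1 * (m powr (- s) / s)"
    unfolding green_def abs_mult using assms left_solution_bounds[of "min x y"] right_solution_bounds[OF m(1,2)]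
    by (intro mult_mono) (auto simp: m_def s_def)
  also have "m powr (- s) = m powr (- s / 2) * m powr (- s / 2)"
    by (simp flip: powr_add)
  also have "\<dots> \<le> x powr (- s / 2) * y powr (- s / 2)"
    using assms m s by (intro mult_mono powr_mono2') auto
  finally have "\<bar>green \<beta> x y\<bar> \<le> x powr (- s / 2) * y powr (- s / 2) / s"
    using s by (simp add: divide_right_mono)
  also have "\<dots> = green_bound \<beta> x * green_bound \<beta> y"
    using s by (simp add: green_bound_def s_def[symmetric])
  finally show ?thesis .
qed

lemma square_integrable_green_bound: "square_integrable (green_bound \<beta>)"
proof -
  define s where "s = \<bar>1 - \<beta>\<bar>"
  have s: "0 < s" "s < 1" using neq_1 pos less_2 by (auto simp: s_def)
  have "continuous_on {0<..<1} (green_bound \<beta>)"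
    unfolding green_bound_def[abs_def] using neq_1 by (intro continuous_intros) auto
  then have meas: "green_bound \<beta> \<in> borel_measurable unit_ivl_measure"
    by (intro continuous_imp_measurable_on_sets_lebesgue) auto
  have "(\<lambda>x::real. x powr (- s)) integrable_on {0..1}"
    using s by (intro integrable_on_powr_from_0) auto
  then have "(\<lambda>x::real. x powr (- s)) integrable_on {0<..<1}"
    by (simp add: integrable_on_Icc_iff_Ioo)
  then have "(\<lambda>x::real. x powr (- s)) absolutely_integrable_on {0<..<1}"
    by (rule nonnegative_absolutely_integrable_1) simp
  then have "integrable unit_ivl_measure (\<lambda>x. x powr (- s))"
    by (rule absolutely_integrable_imp_integrable) simp
  then have "integrable unit_ivl_measure (\<lambda>x. x powr (- s) / s)" by simp
  moreover have "(green_bound \<beta> x)\<^sup>2 = x powr (- s) / s" for x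
    using s by (simp add: green_bound_def power_divide s_def[symmetric] power2_eq_square flip: powr_add)
  ultimately show ?thesis
    using meas by (simp add: square_integrable_def)
qed

sublocale dominated_symmetric_kernel "green \<beta>" "green_bound \<beta>"
proof
  have id: "(\<lambda>x. x) \<in> borel_measurable unit_ivl_measure"
    by (intro continuous_imp_measurable_on_sets_lebesgue) auto
  have [measurable]: "fst \<in> borel_measurable (unit_ivl_measure \<Otimes>\<^sub>M unit_ivl_measure)"
    "snd \<in> borel_measurable (unit_ivl_measure \<Otimes>\<^sub>M unit_ivl_measure)"
    by (rule measurable_compose[OF measurable_fst id], rule measurable_compose[OF measurable_snd id])
  have "case_prod (green \<beta>) = (\<lambda>p. (if \<beta> < 1 then min (fst p) (snd p) powr (1 - \<beta>) else 1)
      * ((1 - max (fst p) (snd p) powr (1 - \<beta>)) / (1 - \<beta>)))"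
    by (simp add: green_def left_solution_def right_solution_def fun_eq_iff)
  also have "\<dots> \<in> borel_measurable (unit_ivl_measure \<Otimes>\<^sub>M unit_ivl_measure)"
    by measurable
  finally show "case_prod (green \<beta>) \<in> borel_measurable (unit_ivl_measure \<Otimes>\<^sub>M unit_ivl_measure)" .
  show "green \<beta> x y = green \<beta> y x" for x y
    by (simp add: green_def min.commute max.commute)
  show "0 \<le> green_bound \<beta> x" for x
    by (simp add: green_bound_def)
qed (auto intro: square_integrable_green_bound green_le)

text \<open>The boundary condition at the origin is hidden in the continuity of \<open>v\<close>: a nonzero limit
\<open>c\<close> of the flux would make \<open>v'\<close> behave like \<open>c x powr (- \<beta>)\<close>, which is not integrable.  The
proof applies the mean value theorem on \<open>[x, 2 x]\<close>, where \<open>z powr \<beta> \<le> z \<le> 2 x\<close> bounds the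
flux at the intermediate point by \<open>2 * \<bar>v (2 x) - v x\<bar>\<close>.\<close>

lemma flux_limit_zero:
  assumes "1 < \<beta>" and v: "continuous_on {0..1} v" "\<And>x. 0 < x \<Longrightarrow> x < 1 \<Longrightarrow> v differentiable at x"
    and w: "continuous_on {0..1} w" "\<And>x. 0 < x \<Longrightarrow> x < 1 \<Longrightarrow> flux \<beta> v x = w x"
  shows "w 0 = 0"
proof -
  define x :: "nat \<Rightarrow> real" where "x n = inverse (real (Suc n)) / 3" for n
  have x: "0 < x n" "2 * x n < 1" for n
    using inverse_le_1_iff[of "real (Suc n)"] by (auto simp: x_def)
  have "\<exists>z. x n < z \<and> z < 2 * x n \<and> v (2 * x n) - v (x n) = (2 * x n - x n) * deriv v z" for n
  proof (rule MVT2)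
    show "x n < 2 * x n" using x[of n] by simp
    fix t assume "x n \<le> t" "t \<le> 2 * x n"
    then show "DERIV v t :> deriv v t"
      using x[of n] by (simp add: DERIV_deriv_iff_real_differentiable v(2))
  qed
  then obtain z where z: "\<And>n. x n < z n" "\<And>n. z n < 2 * x n"
    "\<And>n. v (2 * x n) - v (x n) = x n * deriv v (z n)"
    by (metis add_diff_cancel mult_2)
  have x0: "x \<longlonglongrightarrow> 0"
    unfolding x_def using tendsto_divide[OF LIMSEQ_inverse_real_of_nat tendsto_const[of 3]] by simp
  have x20: "(\<lambda>n. 2 * x n) \<longlonglongrightarrow> 0"
    using tendsto_mult[OF tendsto_const[of 2] x0] by simp
  have z0: "z \<longlonglongrightarrow> 0"
    using z(1,2) by (intro tendsto_sandwich[OF _ _ x0 x20]) (auto intro!: always_eventually less_imp_le)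
  have z01: "0 < z n" "z n < 1" for n
    using x[of n] z(1,2)[of n] by auto
  have lim_v: "(\<lambda>n. v (y n)) \<longlonglongrightarrow> v 0" if "y \<longlonglongrightarrow> 0" "\<And>n. y n \<in> {0..1}" for y :: "nat \<Rightarrow> real"
    using that by (intro continuous_on_tendsto_compose[OF v(1)]) auto
  have mem: "x n \<in> {0..1}" "2 * x n \<in> {0..1}" for n
    using x[of n] by auto
  have lim_w: "(\<lambda>n. w (z n)) \<longlonglongrightarrow> w 0"
    using z01 by (intro continuous_on_tendsto_compose[OF w(1) z0]) (auto intro!: always_eventually less_imp_le)
  have "(\<lambda>n. v (2 * x n) - v (x n)) \<longlonglongrightarrow> v 0 - v 0"
    using lim_v[OF x20 mem(2)] lim_v[OF x0 mem(1)] by (rule tendsto_diff)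
  then have "(\<lambda>n. 2 * \<bar>v (2 * x n) - v (x n)\<bar>) \<longlonglongrightarrow> 2 * \<bar>v 0 - v 0\<bar>"
    by (intro tendsto_mult tendsto_rabs tendsto_const)
  then have bound_0: "(\<lambda>n. 2 * \<bar>v (2 * x n) - v (x n)\<bar>) \<longlonglongrightarrow> 0" by simp
  have "norm (w (z n)) \<le> 2 * \<bar>v (2 * x n) - v (x n)\<bar>" for n
  proof -
    have "z n powr \<beta> \<le> z n powr 1"
      using z01[of n] assms(1) by (intro powr_mono') auto
    then have "z n powr \<beta> \<le> 2 * x n"
      using z(2)[of n] z01(1)[of n] by simp
    then have "z n powr \<beta> * \<bar>deriv v (z n)\<bar> \<le> 2 * x n * \<bar>deriv v (z n)\<bar>"
      by (rule mult_right_mono) simp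
    then show ?thesis
      using w(2)[OF z01, of n] x(1)[of n] by (simp add: z(3) flux_def abs_mult flip: w(2)[OF z01])
  qed
  then have "(\<lambda>n. w (z n)) \<longlonglongrightarrow> 0"
    by (intro Lim_null_comparison[OF _ bound_0] always_eventually allI)
  with lim_w show ?thesis
    by (rule LIMSEQ_unique)
qed

text \<open>Both pieces of the integral have explicit antiderivatives, Lagrange's bilinear expressions \<open>W\<close>
and \<open>Z\<close> of \<open>v\<close> with the left and with the right solution.  Their boundary terms at \<open>0\<close>
and at \<open>1\<close> vanish, and what is left at \<open>x\<close> is \<open>v x\<close> times the Wronskian.\<close>

lemma green_representation:
  assumes v: "v \<in> degenerate_domain \<beta>" and x: "0 < x" "x < 1"
  shows "v x = (LINT y|unit_ivl_measure. green \<beta> x y * degenerate_expr \<beta> v y)"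
proof -
  define F where "F = flux \<beta> v"
  from v obtain w where v_cont: "continuous_on {0..1} v"
    and v_diff: "\<And>x. 0 < x \<Longrightarrow> x < 1 \<Longrightarrow> v differentiable at x"
    and w_cont: "continuous_on {0..1} w" and F_w: "\<And>x. 0 < x \<Longrightarrow> x < 1 \<Longrightarrow> F x = w x"
    and F_diff: "\<And>x. 0 < x \<Longrightarrow> x < 1 \<Longrightarrow> F differentiable at x"
    and sq: "square_integrable (degenerate_expr \<beta> v)"
    and v0: "\<beta> < 1 \<Longrightarrow> v 0 = 0" and v1: "v 1 = 0"
    unfolding degenerate_domain_def F_def by auto
  have v_deriv: "(v has_real_derivative deriv v y) (at y)" if "0 < y" "y < 1" for y
    using v_diff[OF that] by (simp add: DERIV_deriv_iff_real_differentiable)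
  have w_deriv: "(w has_real_derivative deriv F y) (at y)" if "0 < y" "y < 1" for y
  proof (rule has_field_derivative_transform_within_open)
    show "(F has_real_derivative deriv F y) (at y)"
      using F_diff[OF that] by (simp add: DERIV_deriv_iff_real_differentiable)
    show "y \<in> {0<..<1}" using that by simp
  qed (auto simp: F_w)
  have flux_eq: "y powr (- \<beta>) * w y = deriv v y" if "0 < y" "y < 1" for y
    using F_w[OF that] that by (simp add: F_def flux_def powr_minus flip: F_w[OF that])
  define W where "W y = left_solution \<beta> y * w y - left_flux \<beta> * v y" for y
  define Z where "Z y = right_solution \<beta> y * w y + v y" for y
  have "((\<lambda>y. left_solution \<beta> y * deriv F y) has_integral W x - W 0) {0..x}"
  proof (rule fundamental_theorem_of_calculus_interior)
    show "continuous_on {0..x} W"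
      unfolding W_def using x
      by (intro continuous_intros continuous_on_subset[OF left_solution_continuous]
          continuous_on_subset[OF w_cont] continuous_on_subset[OF v_cont]) auto
    fix y assume "y \<in> {0<..<x}"
    then have y: "0 < y" "y < 1" using x by auto
    show "(W has_vector_derivative left_solution \<beta> y * deriv F y) (at y)"
      unfolding W_def[abs_def] has_real_derivative_iff_has_vector_derivative[symmetric]
      by (rule derivative_eq_intros left_solution_deriv[OF y(1)] w_deriv[OF y] v_deriv[OF y] refl)+
         (simp add: flux_eq[OF y, symmetric])
  qed (use x in simp)
  moreover have "W 0 = 0"
  proof (cases "\<beta> < 1")
    case True
    then show ?thesis by (simp add: W_def left_solution_def v0)
  next
    case False
    then have "w 0 = 0"
      using neq_1 v_cont v_diff w_cont F_w unfolding F_def by (intro flux_limit_zero) auto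
    with False show ?thesis by (simp add: W_def left_flux_def)
  qed
  ultimately have "((\<lambda>y. left_solution \<beta> y * deriv F y) has_integral W x) {0..x}" by simp
  from has_integral_mult_right[OF this, of "- right_solution \<beta> x"]
  have left: "((\<lambda>y. green \<beta> x y * degenerate_expr \<beta> v y) has_integral - right_solution \<beta> x * W x) {0..x}"
    by (rule has_integral_eq[rotated])
       (simp add: green_def degenerate_expr_def F_def min_absorb2 max_absorb1)
  have "((\<lambda>y. right_solution \<beta> y * deriv F y) has_integral Z 1 - Z x) {x..1}"
  proof (rule fundamental_theorem_of_calculus_interior)
    have "continuous_on {x..1} (right_solution \<beta>)"
      using x right_solution_deriv by (intro DERIV_continuous_on[where D = "\<lambda>y. - (y powr (- \<beta>))"])
        (auto intro: has_field_derivative_at_within)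
    then show "continuous_on {x..1} Z"
      unfolding Z_def using x
      by (intro continuous_intros continuous_on_subset[OF w_cont] continuous_on_subset[OF v_cont]) auto
    fix y assume "y \<in> {x<..<1}"
    then have y: "0 < y" "y < 1" using x by auto
    show "(Z has_vector_derivative right_solution \<beta> y * deriv F y) (at y)"
      unfolding Z_def[abs_def] has_real_derivative_iff_has_vector_derivative[symmetric]
      by (rule derivative_eq_intros right_solution_deriv[OF y(1)] w_deriv[OF y] v_deriv[OF y] refl)+
         (simp add: flux_eq[OF y, symmetric])
  qed (use x in simp)
  moreover have "Z 1 = 0"
    by (simp add: Z_def right_solution_def v1)
  ultimately have "((\<lambda>y. right_solution \<beta> y * deriv F y) has_integral - Z x) {x..1}" by simp
  from has_integral_mult_right[OF this, of "- left_solution \<beta> x"]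
  have right: "((\<lambda>y. green \<beta> x y * degenerate_expr \<beta> v y) has_integral - left_solution \<beta> x * - Z x) {x..1}"
    by (rule has_integral_eq[rotated])
       (simp_all add: green_def degenerate_expr_def F_def min_absorb1 max_absorb2)
  have "((\<lambda>y. green \<beta> x y * degenerate_expr \<beta> v y) has_integral
      - right_solution \<beta> x * W x + - left_solution \<beta> x * - Z x) {0..1}"
    using x left right by (intro has_integral_combine[of 0 x 1]) auto
  also have "- right_solution \<beta> x * W x + - left_solution \<beta> x * - Z x
      = (left_solution \<beta> x + left_flux \<beta> * right_solution \<beta> x) * v x"
    by (simp add: W_def Z_def algebra_simps)
  also have "\<dots> = v x"
    using left_right_identity[OF x(1)] by simp
  finally have "integral {0<..<1} (\<lambda>y. green \<beta> x y * degenerate_expr \<beta> v y) = v x"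
    by (simp add: has_integral_Icc_iff_Ioo integral_unique)
  moreover have "integrable unit_ivl_measure (\<lambda>y. green \<beta> x y * degenerate_expr \<beta> v y)"
    using square_integrable_mult[OF square_integrable_kernel_section[OF x] sq] .
  ultimately show ?thesis
    by (simp add: lebesgue_integral_eq_integral)
qed

lemma integral_op_degenerate_operator:
  assumes "(v, g) \<in> degenerate_operator \<beta>"
  shows "integral_op (green \<beta>) g = v"
proof -
  obtain u where u: "u \<in> degenerate_domain \<beta>" and v: "v = abs_L2 u" and g: "g = abs_L2 (degenerate_expr \<beta> u)"
    using assms unfolding degenerate_operator_def by auto
  have "square_integrable u" "square_integrable (degenerate_expr \<beta> u)"
    using u by (auto simp: degenerate_domain_def square_integrable_continuous)
  then show ?thesis
    unfolding v g by (intro integral_op_abs_L2 green_representation u)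
qed

section \<open>Polynomial right-hand sides and the Friedrichs extension\<close>

text \<open>For a monomial the equation can be integrated explicitly: \<open>- x powr (i + 2 - \<beta>)\<close> divided by
\<open>(i + 1) (i + 2 - \<beta>)\<close> is a particular solution for \<open>x ^ i\<close>, and adding the left solution
with the same factor corrects the value at \<open>1\<close> without disturbing the condition at \<open>0\<close>.\<close>

lemma polynomial_in_range:
  assumes "real_polynomial_function p"
  shows "(integral_op (green \<beta>) (abs_L2 p), abs_L2 p) \<in> degenerate_operator \<beta>"
proof -
  obtain a n where p: "p = (\<lambda>x. \<Sum>i\<le>n. a i * x ^ i)"
    using real_polynomial_function_imp_sum[OF assms] by blast
  define b where "b i = a i / ((real i + 1) * (real i + 2 - \<beta>))" for i
  have d: "real i + 2 - \<beta> > 0" for i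
    using less_2 by simp
  have b: "b i * (real i + 2 - \<beta>) = a i / (real i + 1)" for i
  proof -
    have "x / (y * z) * z = x / y" if "z > 0" for x y z :: real
      using that by simp
    then show ?thesis
      unfolding b_def using d by blast
  qed
  define v where "v x = (\<Sum>i\<le>n. b i * (left_solution \<beta> x - x powr (real i + 2 - \<beta>)))" for x
  define F where "F x = (\<Sum>i\<le>n. b i * left_flux \<beta> - a i / (real i + 1) * x ^ Suc i)" for x :: real
  have v_deriv: "(v has_real_derivative x powr (- \<beta>) * F x) (at x)" if "0 < x" for x
  proof -
    have "(v has_real_derivative (\<Sum>i\<le>n. b i * (left_flux \<beta> * x powr (- \<beta>)
        - (real i + 2 - \<beta>) * x powr (real i + 2 - \<beta> - 1)))) (at x)"
      unfolding v_def[abs_def]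
      by (intro DERIV_sum DERIV_cmult DERIV_diff left_solution_deriv has_real_derivative_powr that)
    also have "(\<Sum>i\<le>n. b i * (left_flux \<beta> * x powr (- \<beta>)
        - (real i + 2 - \<beta>) * x powr (real i + 2 - \<beta> - 1))) = x powr (- \<beta>) * F x"
      unfolding F_def sum_distrib_left
    proof (rule sum.cong[OF refl])
      fix i
      have "x powr (real i + 2 - \<beta> - 1) = x powr (- \<beta> + real (Suc i))"
        by (rule arg_cong[where f = "\<lambda>r. x powr r"]) simp
      also have "\<dots> = x powr (- \<beta>) * x ^ Suc i"
        using that by (simp only: powr_add powr_realpow)
      finally show "b i * (left_flux \<beta> * x powr (- \<beta>)
          - (real i + 2 - \<beta>) * x powr (real i + 2 - \<beta> - 1))
          = x powr (- \<beta>) * (b i * left_flux \<beta> - a i / (real i + 1) * x ^ Suc i)"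
        by (simp add: right_diff_distrib b[symmetric] mult_ac)
    qed
    finally show ?thesis .
  qed
  have flux_v: "flux \<beta> v x = F x" if "0 < x" for x
    using DERIV_imp_deriv[OF v_deriv[OF that]] that by (simp add: flux_def powr_minus)
  have F_deriv: "(F has_real_derivative - p x) (at x)" for x
  proof -
    have "((\<lambda>x. b i * left_flux \<beta> - a i / (real i + 1) * x ^ Suc i) has_real_derivative
        - (a i * x ^ i)) (at x)" for i
    proof -
      have "((\<lambda>x. b i * left_flux \<beta> - a i / (real i + 1) * x ^ Suc i) has_real_derivative
          0 - a i / (real i + 1) * (real (Suc i) * x ^ (Suc i - Suc 0))) (at x)"
        by (intro DERIV_diff DERIV_const DERIV_cmult DERIV_pow)
      moreover have "a i / (real i + 1) * (real (Suc i) * x ^ i) = a i * x ^ i"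
      proof -
        have "y / z * (z * t) = y * t" if "z > 0" for y z t :: real
          using that by simp
        from this[of "real i + 1"] show ?thesis by (simp add: add.commute)
      qed
      ultimately show ?thesis by simp
    qed
    from DERIV_sum[of "{..n}", OF this] show ?thesis
      unfolding F_def[abs_def] p by (simp add: sum_negf)
  qed
  have flux_deriv: "(flux \<beta> v has_real_derivative - p x) (at x)" if "0 < x" for x
    using F_deriv by (rule has_field_derivative_transform_within_open[where S = "{0<..}"])
      (use that in \<open>auto simp: flux_v\<close>)
  have p_cont: "continuous_on {0..1} p"
    unfolding p by (intro continuous_intros)
  have expr: "degenerate_expr \<beta> v x = p x" if "0 < x" for x
    using DERIV_imp_deriv[OF flux_deriv[OF that]] by (simp add: degenerate_expr_def)
  have sq_p: "square_integrable p"
    using p_cont by (rule square_integrable_continuous)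
  have sq: "square_integrable (degenerate_expr \<beta> v)"
  proof (rule square_integrable_dominated)
    show "degenerate_expr \<beta> v \<in> borel_measurable unit_ivl_measure"
      using sq_p by (subst measurable_cong[where g = p]) (auto simp: expr square_integrable_def)
    show "square_integrable (\<lambda>x. \<bar>p x\<bar>)"
      using sq_p by (auto simp: square_integrable_def)
    show "AE x in unit_ivl_measure. \<bar>degenerate_expr \<beta> v x\<bar> \<le> \<bar>p x\<bar>"
      by (rule AE_unit_ivl_I) (simp add: expr)
  qed
  have "abs_continuous_on_ivl 0 1 (\<lambda>x. - p x)"
  proof (rule abs_continuous_on_ivl_lipschitz)
    fix x y :: real assume "0 \<le> x" "x \<le> 1" "0 \<le> y" "y \<le> 1"
    from polynomial_lipschitz_unit_ivl[OF this, of a n]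
    show "\<bar>- p y - - p x\<bar> \<le> ((\<Sum>i\<le>n. \<bar>a i\<bar> * real i) + 1) * \<bar>y - x\<bar>"
      unfolding p by (simp add: distrib_right)
  qed (simp add: add_nonneg_pos sum_nonneg)
  moreover have "continuous_on {0..1} v"
    unfolding v_def using d
    by (intro continuous_intros left_solution_continuous continuous_on_powr') auto
  moreover have "continuous_on {0..1} F"
    unfolding F_def by (intro continuous_intros)
  moreover have "\<beta> < 1 \<longrightarrow> v 0 = 0"
    by (simp add: v_def left_solution_def)
  moreover have "v 1 = 0"
    by (simp add: v_def left_solution_def)
  moreover have "\<forall>x\<in>{0<..<1}. v differentiable at x" "\<forall>x\<in>{0<..<1}. flux \<beta> v differentiable at x"
    using v_deriv flux_deriv unfolding real_differentiable_def
    by (metis greaterThanLessThan_iff)+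
  moreover have "\<forall>x\<in>{0<..<1}. deriv (flux \<beta> v) x = - p x"
    using DERIV_imp_deriv[OF flux_deriv] by auto
  ultimately have v: "v \<in> degenerate_domain \<beta>"
    unfolding degenerate_domain_def using sq flux_v by auto
  have "abs_L2 (degenerate_expr \<beta> v) = abs_L2 p"
    using sq sq_p by (intro abs_L2_eqI AE_unit_ivl_I expr)
  then have mem: "(abs_L2 v, abs_L2 p) \<in> degenerate_operator \<beta>"
    using v unfolding degenerate_operator_def by force
  with integral_op_degenerate_operator[OF mem] show ?thesis by simp
qed

text \<open>Uniqueness comes from density alone: for \<open>(u, f)\<close> in the adjoint, \<open>u - K f\<close> is orthogonal to
every polynomial.  For the form domain, the energy of \<open>K h\<close> is \<open>\<langle>h, K h\<rangle>\<close> and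
hence bounded by a multiple of \<open>\<parallel>h\<parallel>\<^sup>2\<close>; polynomials approximating \<open>f\<close> therefore give a
sequence that is Cauchy in energy.\<close>

lemma friedrichs_extension_degenerate_operator:
  "friedrichs_extension (degenerate_operator \<beta>) = range (\<lambda>f. (integral_op (green \<beta>) f, f))"
proof -
  define K where "K = integral_op (green \<beta>)"
  define P where "P = {abs_L2 p |p. real_polynomial_function p}"
  have P: "(K g, g) \<in> degenerate_operator \<beta>" if "g \<in> P" for g
    using that polynomial_in_range unfolding P_def K_def by auto
  have dense: "f \<in> closure P" for f
  proof -
    obtain h where "square_integrable h" "f = abs_L2 h"
      by (rule L2_representative)
    then show ?thesis
      unfolding P_def by (simp only: polynomials_dense_L2)
  qed
  have sym: "inner (K u) v = inner u (K v)" for u v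
    unfolding K_def by (rule symmetric_integral_op)
  have KA: "K g = v" if "(v, g) \<in> degenerate_operator \<beta>" for v g
    using integral_op_degenerate_operator[OF that] by (simp add: K_def)
  have "u = K f" if uf: "(u, f) \<in> adjoint_op (degenerate_operator \<beta>)" for u f
  proof -
    have "inner (u - K f) g = 0" if "g \<in> P" for g
    proof -
      have "inner u g = inner f (K g)"
        using uf P[OF that] unfolding adjoint_op_def by auto
      then show ?thesis
        by (simp add: inner_diff_left sym)
    qed
    then have "P \<subseteq> {g. inner (u - K f) g = 0}" by blast
    then have "closure P \<subseteq> {g. inner (u - K f) g = 0}"
      by (rule closure_minimal) (intro closed_Collect_eq continuous_intros)
    then have "inner (u - K f) (u - K f) = 0"
      using dense by blast
    then show ?thesis by simp
  qed
  moreover have "(K f, f) \<in> adjoint_op (degenerate_operator \<beta>)" for f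
    unfolding adjoint_op_def using KA by (auto simp: sym)
  moreover have "K f \<in> form_domain (degenerate_operator \<beta>)" for f
  proof -
    obtain g where g: "\<And>n::nat. g n \<in> P" "g \<longlonglongrightarrow> f"
      using dense[of f] unfolding closure_sequential by blast
    define C where "C = sqrt ((norm (abs_L2 (green_bound \<beta>))) ^ 4) + 1"
    have C: "C > 0" by (simp add: C_def add_nonneg_pos)
    have K_diff: "K (u - v) = K u - K v" for u v
      unfolding K_def by (rule integral_op.K_simps)
    have energy: "inner h (K h) \<le> C * (norm h)\<^sup>2" for h
    proof -
      have "inner h (K h) \<le> norm h * norm (K h)"
        by (rule norm_cauchy_schwarz)
      also have "\<dots> \<le> norm h * (C * norm h)"
        using integral_op.norm_K_le[of h] unfolding K_def C_def
        by (intro mult_left_mono) (auto simp: distrib_right intro: order_trans)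
      finally show ?thesis by (simp add: power2_eq_square mult_ac)
    qed
    have "\<exists>N. \<forall>m\<ge>N. \<forall>n\<ge>N. inner (g m - g n) (K (g m) - K (g n)) < e" if "e > 0" for e
    proof -
      have "Cauchy g" using g(2) by (rule LIMSEQ_imp_Cauchy)
      moreover have "sqrt (e / C) > 0" using that C by simp
      ultimately obtain N where N: "\<And>m n. m \<ge> N \<Longrightarrow> n \<ge> N \<Longrightarrow> norm (g m - g n) < sqrt (e / C)"
        by (meson CauchyD)
      have "inner (g m - g n) (K (g m) - K (g n)) < e" if "m \<ge> N" "n \<ge> N" for m n
      proof -
        have "(norm (g m - g n))\<^sup>2 < (sqrt (e / C))\<^sup>2"
          using N[OF that] by (intro power_strict_mono) auto
        then have "C * (norm (g m - g n))\<^sup>2 < e"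
          using C \<open>e > 0\<close> by (simp add: field_simps)
        with energy[of "g m - g n"] show ?thesis by (simp add: K_diff)
      qed
      then show ?thesis by blast
    qed
    moreover have "(\<lambda>n. K (g n)) \<longlonglongrightarrow> K f"
      unfolding K_def by (rule bounded_linear.tendsto[OF integral_op.bounded_linear_K g(2)])
    ultimately show ?thesis
      unfolding form_domain_def using P[OF g(1)]
      by (intro CollectI exI[of _ "\<lambda>n. K (g n)"] exI[of _ g]) simp
  qed
  ultimately show ?thesis
    unfolding friedrichs_extension_def K_def[symmetric] by auto
qed

end

theorem theorem5p2:
  fixes \<beta> :: real
  assumes "0 < \<beta>" and "\<beta> < 2" and "\<beta> \<noteq> 1"
  shows "discrete_spectrum (friedrichs_extension (degenerate_operator \<beta>))"
proof -
  interpret degenerate_exponent \<beta>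
    using assms by unfold_locales
  show ?thesis
    unfolding friedrichs_extension_degenerate_operator
    by (rule integral_op.discrete_spectrum_inverse_graph)
qed

end
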